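(* Let $G=(V,E)$ be a finite quiver without self-loops, with $V=\{1,\dots,p\}$, let $n_v\ge1$ be integers for $v\in V$, let $(x_e)_{e\in E}$ be complex numbers, and let $(U_e)_{e\in E}$ be complex matrices, $U_e$ of size $n_{s(e)}\times n_{t(e)}$. Let $\Delta$ be the associated twisted Laplacian. Then $$\det\Delta=\sum_{\mathsf{C}\in\mathcal{C}(G)_{\le\underline{n}}}\frac{\underline{z}^{\underline{n}-\underline{v}(\mathsf{C})}}{\mathsf{C}!}\prod_{\mathsf{c}\in\mathsf{C}}\frac{-\underline{x}^{\underline{e}(\mathsf{c})}\operatorname{Tr}\operatorname{hol}(\mathsf{c})}{\operatorname{val}(\mathsf{c})},$$ where the product over $\mathsf{c}\in\mathsf{C}$ takes multiplicities into account.
   Context: A finite quiver is a finite directed graph (multiple edges allowed); each edge $e$ goes from $s(e)$ to $t(e)$, and no self-loops means $s(e)\ne t(e)$ for all $e$. The twisted Laplacian is the endomorphism of $\bigoplus_{v\in V}\mathbb{C}^{n_v}$ given by $\Delta f(v)=\sum_{e\in E:\,s(e)=v}x_e\,[f(s(e))-U_ef(t(e))]$. For $a\in V$, $z_a=\sum_{e\in E:\,s(e)=a}x_e$. A cycle $\mathsf{c}$ on $G$ is a sequence of edges $(e_1,\dots,e_k)$, $k\ge 1$, with $t(e_i)=s(e_{i+1})$ for $1\le i<k$ and $t(e_k)=s(e_1)$, considered up to cyclic permutation (vertices and edges may be repeated). Its valuation $\operatorname{val}(\mathsf{c})$ is the order of the stabiliser of $(e_1,\dots,e_k)$ under the cyclic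 shift action of $\mathbb{Z}/k\mathbb{Z}$; $\underline{x}^{\underline{e}(\mathsf{c})}=x_{e_1}\cdots x_{e_k}$; $\operatorname{hol}(\mathsf{c})=U_{e_1}\cdots U_{e_k}$, whose trace does not depend on the starting point; $v_a(\mathsf{c})=|\{i:s(e_i)=a\}|$. For a finite multiset $\mathsf{C}$ of cycles, $v_a(\mathsf{C})=\sum_{\mathsf{c}\in\mathsf{C}}v_a(\mathsf{c})$ (with multiplicities), and $\mathsf{C}!$ is the product of the factorials of the multiplicities. $\mathcal{C}(G)_{\le\underline{n}}$ is the set of multisets $\mathsf{C}$ of cycles on $G$ (including the empty one) with $v_a(\mathsf{C})\le n_a$ for all $a\in V$. $\underline{z}^{\underline{n}-\underline{v}(\mathsf{C})}=\prod_{a\in V}z_a^{n_a-v_a(\mathsf{C})}$, with $z^0=1$. *)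

theory Defs
  imports
    "Jordan_Normal_Form.Determinant"
    "Graph_Theory.Arc_Walk"
    "HOL-Library.Multiset"
    Complex_Main
begin

section \<open>The twisted Laplacian\<close>

text \<open>
  Quivers are \<^typ>\<open>('a, 'b) pre_digraph\<close> values, with \<^const>\<open>tail\<close> for the source and
  \<^const>\<open>head\<close> for the target of an edge. A vector of the direct sum of the spaces
  \<open>complex^(n v)\<close> is a function \<open>f\<close> with \<open>f v\<close> in \<open>carrier_vec (n v)\<close> for every vertex \<open>v\<close>.
\<close>

definition twisted_laplacian ::
  "('a, 'b) pre_digraph \<Rightarrow> ('a \<Rightarrow> nat) \<Rightarrow> ('b \<Rightarrow> complex) \<Rightarrow> ('b \<Rightarrow> complex mat)
    \<Rightarrow> ('a \<Rightarrow> complex vec) \<Rightarrow> ('a \<Rightarrow> complex vec)" where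
  "twisted_laplacian G n x U f = (\<lambda>v.
     finsum_vec TYPE(complex) (n v)
       (\<lambda>e. x e \<cdot>\<^sub>v (f (tail G e) - U e *\<^sub>v f (head G e))) (out_arcs G v))"

text \<open>
  The standard basis vector labelled by \<open>(v, i)\<close> is the \<open>i\<close>-th unit vector of the summand
  at \<open>v\<close>; \<open>basis_index\<close> lists the labels lexicographically.
\<close>

definition basis_vector :: "('a \<Rightarrow> nat) \<Rightarrow> 'a \<times> nat \<Rightarrow> ('a \<Rightarrow> complex vec)" where
  "basis_vector n = (\<lambda>(v, i) u. if u = v then unit_vec (n v) i else 0\<^sub>v (n u))"

definition basis_index :: "('a :: linorder, 'b) pre_digraph \<Rightarrow> ('a \<Rightarrow> nat) \<Rightarrow> ('a \<times> nat) list" where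
  "basis_index G n =
     concat (map (\<lambda>v. map (Pair v) [0..<n v]) (sorted_list_of_set (verts G)))"

definition direct_sum_matrix ::
  "('a :: linorder, 'b) pre_digraph \<Rightarrow> ('a \<Rightarrow> nat)
    \<Rightarrow> (('a \<Rightarrow> complex vec) \<Rightarrow> ('a \<Rightarrow> complex vec)) \<Rightarrow> complex mat" where
  "direct_sum_matrix G n T =
     (let b = basis_index G n in
      mat (length b) (length b)
        (\<lambda>(j, k). T (basis_vector n (b ! k)) (fst (b ! j)) $ snd (b ! j)))"

definition direct_sum_det ::
  "('a :: linorder, 'b) pre_digraph \<Rightarrow> ('a \<Rightarrow> nat)
    \<Rightarrow> (('a \<Rightarrow> complex vec) \<Rightarrow> ('a \<Rightarrow> complex vec)) \<Rightarrow> complex" where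
  "direct_sum_det G n T = det (direct_sum_matrix G n T)"

definition out_weight :: "('a, 'b) pre_digraph \<Rightarrow> ('b \<Rightarrow> complex) \<Rightarrow> 'a \<Rightarrow> complex" where
  "out_weight G x a = (\<Sum>e\<in>out_arcs G a. x e)"


section \<open>Closed walks and cycles\<close>

definition cyclic_perm_rel :: "('b list \<times> 'b list) set" where
  "cyclic_perm_rel = {(es, fs). \<exists>m. fs = rotate m es}"

text \<open>
  \<open>wf_digraph.closed_w\<close>: nonempty closed walk, vertices and edges may repeat.
\<close>

definition cycles :: "('a, 'b) pre_digraph \<Rightarrow> 'b list set set" where
  "cycles G = {es. wf_digraph.closed_w G es} // cyclic_perm_rel"

definition walk_visits :: "('a, 'b) pre_digraph \<Rightarrow> 'a \<Rightarrow> 'b list \<Rightarrow> nat" where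
  "walk_visits G a es = card {i. i < length es \<and> tail G (es ! i) = a}"

definition walk_val :: "'b list \<Rightarrow> nat" where
  "walk_val es = card {m. m < length es \<and> rotate m es = es}"

definition walk_weight :: "('b \<Rightarrow> complex) \<Rightarrow> 'b list \<Rightarrow> complex" where
  "walk_weight x es = (\<Prod>e\<leftarrow>es. x e)"

text \<open>
  The trailing identity matrix only closes the fold: it has the size of the columns of the
  last factor.
\<close>

definition walk_hol ::
  "('a, 'b) pre_digraph \<Rightarrow> ('a \<Rightarrow> nat) \<Rightarrow> ('b \<Rightarrow> complex mat) \<Rightarrow> 'b list \<Rightarrow> complex mat" where
  "walk_hol G n U es = foldr (\<lambda>e A. U e * A) es (1\<^sub>m (n (head G (last es))))"

definition mat_trace :: "complex mat \<Rightarrow> complex" where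
  "mat_trace A = (\<Sum>i<dim_row A. A $$ (i, i))"

lemma mset_rotate: "mset (rotate m es) = mset es"
proof (induction m)
  case (Suc m)
  have "mset (rotate1 fs) = mset fs" for fs :: "'a list"
    by (cases fs) auto
  with Suc show ?case by simp
qed simp

lemma walk_visits_rotate: "walk_visits G a (rotate m es) = walk_visits G a es"
proof -
  have "walk_visits G a es = length (filter (\<lambda>e. tail G e = a) es)" for es
    by (simp add: walk_visits_def length_filter_conv_card)
  then show ?thesis
    by (metis mset_filter mset_rotate size_mset)
qed

lemma walk_val_rotate: "walk_val (rotate m es) = walk_val es"
proof -
  have "rotate k (rotate m es) = rotate m es \<longleftrightarrow> rotate k es = es" for k
  proof -
    have "rotate k (rotate m es) = rotate m (rotate k es)"
      by (simp add: rotate_rotate add.commute)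
    moreover have "inj (rotate m :: 'a list \<Rightarrow> 'a list)"
    proof (rule injI)
      fix xs ys :: "'a list"
      assume eq: "rotate m xs = rotate m ys"
      have len: "length xs = length ys"
        using arg_cong[OF eq, of length] by simp
      let ?k = "length xs * m - m"
      have le: "m \<le> length xs * m \<or> xs = []"
        by (cases xs) auto
      show "xs = ys"
      proof (cases "xs = []")
        case False
        with le have "rotate ?k (rotate m zs) = zs" if "length zs = length xs" for zs :: "'a list"
          using that by (metis le_add_diff_inverse2 mod_mult_self1_is_0 rotate_id rotate_rotate)
        then show ?thesis
          using eq len by metis
      qed (use len in simp)
    qed
    ultimately show ?thesis
      by (metis injD)
  qed
  then show ?thesis
    by (simp add: walk_val_def)
qed

lemma walk_weight_rotate: "walk_weight x (rotate m es) = walk_weight x es"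
proof -
  have "walk_weight x fs = prod_mset (image_mset x (mset fs))" for fs
    unfolding walk_weight_def by (metis mset_map prod_mset_prod_list)
  then show ?thesis
    by (simp add: mset_rotate)
qed

lemma mat_trace_comm:
  assumes "A \<in> carrier_mat k l" "B \<in> carrier_mat l k"
  shows "mat_trace (A * B) = mat_trace (B * A)"
proof -
  have "mat_trace (A * B) = (\<Sum>i<k. \<Sum>j<l. A $$ (i, j) * B $$ (j, i))"
    using assms by (simp add: mat_trace_def scalar_prod_def atLeast0LessThan)
  also have "\<dots> = (\<Sum>j<l. \<Sum>i<k. B $$ (j, i) * A $$ (i, j))"
    by (subst sum.swap) (simp add: mult.commute)
  also have "\<dots> = mat_trace (B * A)"
    using assms by (simp add: mat_trace_def scalar_prod_def atLeast0LessThan)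
  finally show ?thesis .
qed

lemma foldr_mat_mult_append:
  fixes U :: "'b \<Rightarrow> complex mat"
  assumes "wf_digraph G"
    and U: "\<And>e. e \<in> arcs G \<Longrightarrow> U e \<in> carrier_mat (n (tail G e)) (n (head G e))"
    and "pre_digraph.awalk G u es v" and B: "B \<in> carrier_mat (n v) k"
  shows "foldr (\<lambda>e A. U e * A) es B \<in> carrier_mat (n u) k"
    and "foldr (\<lambda>e A. U e * A) es B = foldr (\<lambda>e A. U e * A) es (1\<^sub>m (n v)) * B"
proof -
  interpret wf_digraph G by fact
  have "foldr (\<lambda>e A. U e * A) es B \<in> carrier_mat (n u) k \<and>
    foldr (\<lambda>e A. U e * A) es (1\<^sub>m (n v)) \<in> carrier_mat (n u) (n v) \<and>
    foldr (\<lambda>e A. U e * A) es B = foldr (\<lambda>e A. U e * A) es (1\<^sub>m (n v)) * B"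
    using assms(3)
  proof (induction es arbitrary: u)
    case Nil
    then show ?case using B by (auto simp: awalk_Nil_iff)
  next
    case (Cons e es)
    then have e: "e \<in> arcs G" "u = tail G e" and w: "awalk (head G e) es v"
      by (auto simp: awalk_Cons_iff)
    show ?case
      using Cons.IH[OF w] U[OF e(1)] e(2) B
      by (auto simp: assoc_mult_mat[of _ "n (tail G e)" "n (head G e)" _ "n v" _ k]
          intro!: mult_carrier_mat)
  qed
  then show "foldr (\<lambda>e A. U e * A) es B \<in> carrier_mat (n u) k"
    and "foldr (\<lambda>e A. U e * A) es B = foldr (\<lambda>e A. U e * A) es (1\<^sub>m (n v)) * B"
    by auto
qed

lemma closed_w_rotate1:
  assumes "wf_digraph G" "wf_digraph.closed_w G es"
  shows "wf_digraph.closed_w G (rotate1 es)"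
proof -
  interpret wf_digraph G by fact
  obtain e es' where [simp]: "es = e # es'"
    using assms(2) by (cases es) (auto simp: closed_w_def)
  have "awalk (head G e) es' (tail G e)" "awalk (tail G e) [e] (head G e)"
    using assms(2) by (auto simp: closed_w_def awalk_Cons_iff awalk_Nil_iff)
  then have "awalk (head G e) (es' @ [e]) (head G e)"
    by (rule awalk_appendI)
  then show ?thesis
    by (auto simp: closed_w_def)
qed

lemma mat_trace_walk_hol_rotate1:
  assumes "wf_digraph G" "wf_digraph.closed_w G es"
    and U: "\<And>e. e \<in> arcs G \<Longrightarrow> U e \<in> carrier_mat (n (tail G e)) (n (head G e))"
  shows "mat_trace (walk_hol G n U (rotate1 es)) = mat_trace (walk_hol G n U es)"
proof -
  interpret wf_digraph G by fact
  obtain e es' where es [simp]: "es = e # es'"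
    using assms(2) by (cases es) (auto simp: closed_w_def)
  have e: "e \<in> arcs G" and w: "awalk (head G e) es' (tail G e)"
    using assms(2) by (auto simp: closed_w_def awalk_Cons_iff)
  have last: "head G (last es) = tail G e"
    using w by (cases es' rule: rev_cases) (auto simp: awalk_Nil_iff)
  let ?P = "foldr (\<lambda>e A. U e * A) es' (1\<^sub>m (n (tail G e)))"
  have P: "?P \<in> carrier_mat (n (head G e)) (n (tail G e))"
    by (rule foldr_mat_mult_append(1)[OF assms(1) U w]) simp_all
  have "walk_hol G n U (rotate1 es) = foldr (\<lambda>e A. U e * A) es' (U e)"
    using U[OF e] by (simp add: walk_hol_def)
  also have "\<dots> = ?P * U e"
    by (rule foldr_mat_mult_append(2)[OF assms(1) U w U[OF e]])
  finally have "walk_hol G n U (rotate1 es) = ?P * U e" .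
  moreover have "walk_hol G n U es = U e * ?P"
    using last by (simp add: walk_hol_def)
  ultimately show ?thesis
    using mat_trace_comm[OF P U[OF e]] by simp
qed

lemma closed_w_rotate:
  assumes "wf_digraph G" "wf_digraph.closed_w G es"
  shows "wf_digraph.closed_w G (rotate m es)"
  using assms by (induction m) (auto simp: closed_w_rotate1)

lemma mat_trace_walk_hol_rotate:
  assumes "wf_digraph G" "wf_digraph.closed_w G es"
    and "\<And>e. e \<in> arcs G \<Longrightarrow> U e \<in> carrier_mat (n (tail G e)) (n (head G e))"
  shows "mat_trace (walk_hol G n U (rotate m es)) = mat_trace (walk_hol G n U es)"
  using assms by (induction m) (auto simp: mat_trace_walk_hol_rotate1 closed_w_rotate)

text \<open>
  Quantities attached to a cycle are computed on an arbitrary representative; lemmas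
  \<open>walk_visits_rotate\<close> to \<open>mat_trace_walk_hol_rotate\<close> above show that the choice is irrelevant.
\<close>

definition representative :: "'b list set \<Rightarrow> 'b list" where
  "representative c = (SOME es. es \<in> c)"

definition cycle_visits :: "('a, 'b) pre_digraph \<Rightarrow> 'a \<Rightarrow> 'b list set \<Rightarrow> nat" where
  "cycle_visits G a c = walk_visits G a (representative c)"

definition cycle_val :: "'b list set \<Rightarrow> nat" where
  "cycle_val c = walk_val (representative c)"

definition cycle_weight :: "('b \<Rightarrow> complex) \<Rightarrow> 'b list set \<Rightarrow> complex" where
  "cycle_weight x c = walk_weight x (representative c)"

definition cycle_tr_hol ::
  "('a, 'b) pre_digraph \<Rightarrow> ('a \<Rightarrow> nat) \<Rightarrow> ('b \<Rightarrow> complex mat) \<Rightarrow> 'b list set \<Rightarrow> complex" where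
  "cycle_tr_hol G n U c = mat_trace (walk_hol G n U (representative c))"


section \<open>Multisets of cycles\<close>

definition multi_visits :: "('a, 'b) pre_digraph \<Rightarrow> 'a \<Rightarrow> 'b list set multiset \<Rightarrow> nat" where
  "multi_visits G a C = (\<Sum>c\<in>#C. cycle_visits G a c)"

definition multi_fact :: "'c multiset \<Rightarrow> nat" where
  "multi_fact C = (\<Prod>c\<in>set_mset C. fact (count C c))"

definition bounded_multicycles ::
  "('a, 'b) pre_digraph \<Rightarrow> ('a \<Rightarrow> nat) \<Rightarrow> 'b list set multiset set" where
  "bounded_multicycles G n =
     {C. set_mset C \<subseteq> cycles G \<and> (\<forall>a\<in>verts G. multi_visits G a C \<le> n a)}"

lemma equiv_cyclic_perm_rel: "equiv UNIV cyclic_perm_rel"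
proof (rule equivI)
  show "cyclic_perm_rel \<subseteq> UNIV \<times> UNIV"
    by simp
  show "refl cyclic_perm_rel"
    by (auto simp: refl_on_def cyclic_perm_rel_def intro: exI[of _ 0])
  show "sym cyclic_perm_rel"
  proof (rule symI)
    fix es fs :: "'b list"
    assume "(es, fs) \<in> cyclic_perm_rel"
    then obtain m where m: "fs = rotate m es"
      by (auto simp: cyclic_perm_rel_def)
    have "rotate (length es - m mod length es) fs = es"
    proof (cases "es = []")
      case False
      then have "length es - m mod length es + m mod length es = length es"
        using mod_less_divisor[of "length es" m] by auto
      then show ?thesis
        unfolding m by (metis rotate_conv_mod rotate_id mod_self rotate_rotate)
    qed (simp add: m)
    then show "(fs, es) \<in> cyclic_perm_rel"
      unfolding cyclic_perm_rel_def by (auto intro: exI sym)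
  qed
  show "trans cyclic_perm_rel"
    by (auto simp: trans_def cyclic_perm_rel_def rotate_rotate)
qed

lemma representative_cycle:
  assumes "wf_digraph G" "c \<in> cycles G"
  shows "representative c \<in> c" "wf_digraph.closed_w G (representative c)"
proof -
  obtain es where es: "wf_digraph.closed_w G es" and c: "c = cyclic_perm_rel `` {es}"
    using assms(2) by (auto simp: cycles_def elim: quotientE)
  have "es \<in> c"
    using c equiv_cyclic_perm_rel by (auto simp: equiv_def refl_on_def)
  then show *: "representative c \<in> c"
    unfolding representative_def by (rule someI)
  then show "wf_digraph.closed_w G (representative c)"
    using closed_w_rotate[OF assms(1) es] by (auto simp: c cyclic_perm_rel_def)
qed

lemma sum_walk_visits:
  assumes "fin_digraph G" "set es \<subseteq> arcs G"
  shows "(\<Sum>a\<in>verts G. walk_visits G a es) = length es"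
proof -
  interpret fin_digraph G by fact
  have "(\<Sum>a\<in>verts G. walk_visits G a es) =
    card (\<Union>a\<in>verts G. {i. i < length es \<and> tail G (es ! i) = a})"
    unfolding walk_visits_def by (rule card_UN_disjoint[symmetric]) auto
  also have "(\<Union>a\<in>verts G. {i. i < length es \<and> tail G (es ! i) = a}) = {..<length es}"
    using assms(2) by (fastforce simp: set_conv_nth)
  finally show ?thesis by simp
qed

text \<open>
  A big sum over an infinite index set is \<open>0\<close> by convention; finiteness rules this out.
\<close>

lemma finite_bounded_multicycles:
  assumes "fin_digraph G"
  shows "finite (bounded_multicycles G n)"
proof -
  interpret fin_digraph G by fact
  define N where "N = (\<Sum>a\<in>verts G. n a)"
  define S where "S = (\<lambda>es. cyclic_perm_rel `` {es}) ` {es. set es \<subseteq> arcs G \<and> length es \<le> N}"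
  have "finite S"
    unfolding S_def by (intro finite_imageI finite_lists_length_le finite_arcs)
  have "set_mset C \<subseteq> S \<and> size C \<le> N" if C: "C \<in> bounded_multicycles G n" for C
  proof -
    define l where "l c = length (representative c)" for c :: "'b list set"
    have cyc: "c \<in> cycles G" if "c \<in># C" for c
      using C that by (auto simp: bounded_multicycles_def)
    have arcs: "set (representative c) \<subseteq> arcs G" if "c \<in># C" for c
      using representative_cycle(2)[OF wf_digraph cyc[OF that]]
      by (auto simp: closed_w_def awalk_def)
    have pos: "1 \<le> l c" if "c \<in># C" for c
      using representative_cycle(2)[OF wf_digraph cyc[OF that]]
      by (auto simp: closed_w_def l_def Suc_le_eq)
    have l: "l c = (\<Sum>a\<in>verts G. cycle_visits G a c)" if "c \<in># C" for c
      unfolding l_def cycle_visits_def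
      by (rule sum_walk_visits[OF assms arcs[OF that], symmetric])
    have "(\<Sum>c\<in>#C. l c) = (\<Sum>c\<in>#C. \<Sum>a\<in>verts G. cycle_visits G a c)"
      using l by (intro arg_cong[where f = sum_mset] image_mset_cong) auto
    also have "\<dots> = (\<Sum>a\<in>verts G. multi_visits G a C)"
      unfolding multi_visits_def by (induction C) (simp_all add: sum.distrib)
    also have "\<dots> \<le> N"
      unfolding N_def using C by (intro sum_mono) (auto simp: bounded_multicycles_def)
    finally have le: "(\<Sum>c\<in>#C. l c) \<le> N" .
    have "size C = (\<Sum>c\<in>#C. 1)"
      by simp
    also have "\<dots> \<le> (\<Sum>c\<in>#C. l c)"
      using pos by (intro sum_mset_mono) auto
    finally have "size C \<le> N"
      using le by simp
    moreover have "c \<in> S" if c: "c \<in># C" for c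
    proof -
      have "l c \<le> (\<Sum>c\<in>#C. l c)"
        using c by (metis insert_DiffM le_add1 sum_mset.insert image_mset_add_mset)
      then have "length (representative c) \<le> N"
        using le by (simp add: l_def)
      moreover have "c = cyclic_perm_rel `` {representative c}"
      proof -
        have "c \<in> UNIV // cyclic_perm_rel"
          using cyc[OF c] by (auto simp: cycles_def quotient_def)
        then show ?thesis
          using representative_cycle(1)[OF wf_digraph cyc[OF c]] equiv_cyclic_perm_rel
          by (metis Image_singleton_iff equiv_class_eq_iff quotientE)
      qed
      ultimately show ?thesis
        unfolding S_def using arcs[OF c] by blast
    qed
    ultimately show ?thesis by blast
  qed
  then have "bounded_multicycles G n \<subseteq> (\<Union>k\<le>N. {C. set_mset C \<subseteq> S \<and> size C = k})"
    by auto
  moreover have "finite (\<Union>k\<le>N. {C. set_mset C \<subseteq> S \<and> size C = k})"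
    using \<open>finite S\<close> by (intro finite_UN_I) (auto simp flip: multisets_of_size_def)
  ultimately show ?thesis
    by (rule finite_subset)
qed

end

theory Submission
  imports Defs
    "Jordan_Normal_Form.Schur_Decomposition"
    "HOL-Computational_Algebra.Polynomial_FPS"
begin

text \<open>
  In the basis of \<open>basis_index\<close> the twisted Laplacian is \<open>D - A\<close>, where \<open>D\<close> is diagonal with entry
  \<open>out_weight G x v\<close> on the block of \<open>v\<close>, and the \<open>(v, w)\<close> block of \<open>A\<close> is the sum of \<open>x e \<cdot>\<^sub>m U e\<close> over
  the edges from \<open>v\<close> to \<open>w\<close> (\<open>direct_sum_matrix_twisted_laplacian\<close>). Choosing, row by row, either the
  entry of \<open>D\<close> or the one of \<open>- A\<close> gives \<open>det (D - A)\<close> as a sum over sets \<open>S\<close> of rows: a product of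
  out-weights over the rows outside \<open>S\<close>, times the principal minor of \<open>- A\<close> on \<open>S\<close>
  (\<open>det_diag_minus_row_scaled\<close>). The product of out-weights depends only on how many rows of each block
  lie in \<open>S\<close>, so what has to be shown is that, for given numbers \<open>m a\<close>, the principal minors with
  \<open>m a\<close> rows in the block of each \<open>a\<close> add up to the weights of the multisets of cycles that visit each
  \<open>a\<close> exactly \<open>m a\<close> times.

  Multiply each \<open>x e\<close> by a variable \<open>u (tail G e)\<close>. The grouped minors then become the coefficients of
  \<open>det (1 - A\<^sub>u)\<close> as a polynomial in the variables \<open>u a\<close>, and the weights of multisets of cycles
  are the coefficients of \<open>exp (- (\<Sum>k\<ge>1. tr (A\<^sub>u ^ k) / k))\<close>, because \<open>tr (A\<^sub>u ^ k)\<close> is a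
  sum over closed walks with a starting point (\<open>trace_weighted_adjacency_pow\<close>) and a cycle \<open>c\<close> of
  length \<open>k\<close> has \<open>k / cycle_val c\<close> of these (\<open>sum_cycles_of_length\<close>). The two series agree since
  \<open>log det = tr log\<close>.

  Exponential and logarithm are replaced by the recursion that they encode. Write \<open>f k\<close> for the part of
  total degree \<open>k\<close> on either side. Then \<open>f 0 = 1\<close> and
  \<open>k * f k = - (\<Sum>j=1..k. tr (A\<^sub>u ^ j) * f (k - j))\<close>: for the determinant by its eigenvalues
  (\<open>newton_identity_det\<close>), for the multisets by marking one step of one cycle and taking this cycle out
  (\<open>newton_identity_multisets\<close>). The recursion determines \<open>f\<close>, so both sides agree as functions of \<open>u\<close>
  (\<open>principal_minors_eq_multicycles\<close>), and \<open>monomial_identity_transfer\<close> passes from this equality of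
  polynomial functions to their coefficients.
\<close>

section \<open>Determinants and principal minors\<close>

text \<open>
  This is the determinant of the principal submatrix of \<open>- A\<close> on the rows in \<open>S\<close>, written with the
  permutations of all \<open>N\<close> indices: the last product selects those that fix every index outside \<open>S\<close>. In
  this form no renumbering of \<open>S\<close> is needed.
\<close>

definition neg_principal_minor :: "nat \<Rightarrow> 'a :: comm_ring_1 mat \<Rightarrow> nat set \<Rightarrow> 'a" where
  "neg_principal_minor N A S =
     (\<Sum>\<sigma> | \<sigma> permutes {0..<N}. signof \<sigma> *
        ((\<Prod>i\<in>S. - A $$ (i, \<sigma> i)) * (\<Prod>i\<in>{0..<N} - S. if i = \<sigma> i then 1 else 0)))"

text \<open>
  The row factors \<open>w\<close> serve two purposes: with variables in them the determinant generates the principal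
  minors, and with \<open>w = 1\<close> the same minors compute the determinant of the twisted Laplacian.
\<close>

lemma det_diag_minus_row_scaled:
  fixes A :: "'a :: comm_ring_1 mat"
  shows "det (mat N N (\<lambda>(i, j). (if i = j then d i else 0) - w i * A $$ (i, j))) =
    (\<Sum>S\<in>Pow {0..<N}. (\<Prod>i\<in>{0..<N} - S. d i) * (\<Prod>i\<in>S. w i) * neg_principal_minor N A S)"
    (is "det ?M = _")
proof -
  let ?I = "{0..<N}"
  have "det ?M = (\<Sum>\<sigma> | \<sigma> permutes ?I. signof \<sigma> * (\<Prod>i\<in>?I. ?M $$ (i, \<sigma> i)))"
    by (simp add: det_def)
  also have "\<dots> = (\<Sum>\<sigma> | \<sigma> permutes ?I. \<Sum>S\<in>Pow ?I. (\<Prod>i\<in>?I - S. d i) * (\<Prod>i\<in>S. w i) *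
      (signof \<sigma> * ((\<Prod>i\<in>S. - A $$ (i, \<sigma> i)) * (\<Prod>i\<in>?I - S. if i = \<sigma> i then 1 else 0))))"
  proof (rule sum.cong[OF refl])
    fix \<sigma> assume \<sigma>: "\<sigma> \<in> {\<sigma>. \<sigma> permutes ?I}"
    have "(\<Prod>i\<in>?I. ?M $$ (i, \<sigma> i)) =
        (\<Prod>i\<in>?I. w i * - A $$ (i, \<sigma> i) + d i * (if i = \<sigma> i then 1 else 0))"
    proof (rule prod.cong[OF refl])
      fix i assume i: "i \<in> ?I"
      then have "\<sigma> i \<in> ?I"
        using \<sigma> by (simp only: mem_Collect_eq permutes_in_image)
      then show "?M $$ (i, \<sigma> i) = w i * - A $$ (i, \<sigma> i) + d i * (if i = \<sigma> i then 1 else 0)"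
        using i by simp
    qed
    also have "\<dots> = (\<Sum>S\<in>Pow ?I. (\<Prod>i\<in>S. w i * - A $$ (i, \<sigma> i)) *
        (\<Prod>i\<in>?I - S. d i * (if i = \<sigma> i then 1 else 0)))"
      by (rule prod_add) simp
    finally have expand: "(\<Prod>i\<in>?I. ?M $$ (i, \<sigma> i)) = \<dots>" .
    show "signof \<sigma> * (\<Prod>i\<in>?I. ?M $$ (i, \<sigma> i)) = (\<Sum>S\<in>Pow ?I.
        (\<Prod>i\<in>?I - S. d i) * (\<Prod>i\<in>S. w i) *
        (signof \<sigma> * ((\<Prod>i\<in>S. - A $$ (i, \<sigma> i)) * (\<Prod>i\<in>?I - S. if i = \<sigma> i then 1 else 0))))"
      unfolding expand prod.distrib sum_distrib_left by (simp only: mult_ac)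
  qed
  also have "\<dots> = (\<Sum>S\<in>Pow ?I. (\<Prod>i\<in>?I - S. d i) * (\<Prod>i\<in>S. w i) * neg_principal_minor N A S)"
    unfolding neg_principal_minor_def sum_distrib_left by (rule sum.swap)
  finally show ?thesis .
qed


section \<open>Newton identities for a determinant\<close>

lemma upper_triangular_mult:
  fixes A B :: "'a :: comm_ring_1 mat"
  assumes A: "A \<in> carrier_mat N N" "upper_triangular A"
    and B: "B \<in> carrier_mat N N" "upper_triangular B"
  shows "upper_triangular (A * B)"
    and "i < N \<Longrightarrow> (A * B) $$ (i, i) = A $$ (i, i) * B $$ (i, i)"
proof -
  have entry: "(A * B) $$ (i, j) = (\<Sum>k\<in>{0..<N}. A $$ (i, k) * B $$ (k, j))"
    if "i < N" "j < N" for i j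
    using A B that by (simp add: scalar_prod_def)
  have zero: "A $$ (i, k) * B $$ (k, j) = 0" if "i < N" "k < N" "k < i \<or> j < k" for i j k
    using A B that by (auto dest: upper_triangularD)
  show "upper_triangular (A * B)"
  proof (rule upper_triangularI)
    fix i j assume "j < i" "i < dim_row (A * B)"
    then have ij: "j < i" "i < N" using A by auto
    have "(\<Sum>k\<in>{0..<N}. A $$ (i, k) * B $$ (k, j)) = 0"
    proof (intro sum.neutral ballI)
      fix k assume "k \<in> {0..<N}"
      then show "A $$ (i, k) * B $$ (k, j) = 0"
        using ij by (intro zero) auto
    qed
    then show "(A * B) $$ (i, j) = 0"
      using entry[of i j] ij by simp
  qed
  show "(A * B) $$ (i, i) = A $$ (i, i) * B $$ (i, i)" if i: "i < N"
  proof -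
    have "(\<Sum>k\<in>{0..<N}. A $$ (i, k) * B $$ (k, i)) = A $$ (i, i) * B $$ (i, i)"
    proof -
      have "(\<Sum>k\<in>{0..<N} - {i}. A $$ (i, k) * B $$ (k, i)) = 0"
      proof (intro sum.neutral ballI)
        fix k assume "k \<in> {0..<N} - {i}"
        then show "A $$ (i, k) * B $$ (k, i) = 0"
          using i by (intro zero) auto
      qed
      then show ?thesis
        using i by (subst sum.remove[of _ i]) auto
    qed
    then show ?thesis
      using entry[of i i] i by simp
  qed
qed

lemma upper_triangular_pow:
  fixes A :: "'a :: comm_ring_1 mat"
  assumes A: "A \<in> carrier_mat N N" "upper_triangular A"
  shows "upper_triangular (A ^\<^sub>m k) \<and> (\<forall>i<N. (A ^\<^sub>m k) $$ (i, i) = A $$ (i, i) ^ k)"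
proof (induction k)
  case 0
  show ?case using A by auto
next
  case (Suc k)
  then show ?case
    using upper_triangular_mult[OF pow_carrier_mat[OF A(1)] _ A] A by (auto simp: mult.commute)
qed

text \<open>
  The \<open>l i\<close> are the diagonal entries of a triangular matrix similar to \<open>A\<close>.
\<close>

lemma complex_mat_eigenvalues:
  fixes A :: "complex mat"
  assumes A: "A \<in> carrier_mat N N"
  obtains l :: "nat \<Rightarrow> complex"
  where "\<And>t. det (1\<^sub>m N - t \<cdot>\<^sub>m A) = (\<Prod>i<N. 1 - t * l i)"
    and "\<And>k. mat_trace (A ^\<^sub>m k) = (\<Sum>i<N. l i ^ k)"
proof -
  obtain es where "char_poly A = (\<Prod>a\<leftarrow>es. [:- a, 1:])"
    using char_poly_factorized[OF A] by blast
  from schur_decomposition_exists[OF A this] obtain B where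
    B: "B \<in> carrier_mat N N" "upper_triangular B" "similar_mat A B" by blast
  from B(3) obtain P Q where wit: "similar_mat_wit A B P Q"
    by (auto simp: similar_mat_def)
  note D = similar_mat_witD2[OF A wit]
  have "det (1\<^sub>m N - t \<cdot>\<^sub>m A) = (\<Prod>i<N. 1 - t * B $$ (i, i))" for t
  proof -
    have "1\<^sub>m N - t \<cdot>\<^sub>m A = P * (1\<^sub>m N - t \<cdot>\<^sub>m B) * Q"
    proof -
      have "P * (1\<^sub>m N - t \<cdot>\<^sub>m B) = P - P * (t \<cdot>\<^sub>m B)"
        using D by (subst mult_minus_distrib_mat) auto
      also have "\<dots> * Q = P * Q - P * (t \<cdot>\<^sub>m B) * Q"
        using D by (subst minus_mult_distrib_mat) auto
      also have "P * (t \<cdot>\<^sub>m B) * Q = t \<cdot>\<^sub>m (P * B * Q)"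
        using D by (subst mult_smult_distrib) (auto intro!: mult_smult_assoc_mat mult_carrier_mat
          simp del: assoc_mult_mat)
      finally show ?thesis using D by metis
    qed
    then have "similar_mat_wit (1\<^sub>m N - t \<cdot>\<^sub>m A) (1\<^sub>m N - t \<cdot>\<^sub>m B) P Q"
      using D by (intro similar_mat_witI[of _ _ N]) auto
    then have "det (1\<^sub>m N - t \<cdot>\<^sub>m A) = det (1\<^sub>m N - t \<cdot>\<^sub>m B)"
      by (intro det_similar) (auto simp: similar_mat_def)
    also have "\<dots> = prod_list (diag_mat (1\<^sub>m N - t \<cdot>\<^sub>m B))"
      using B by (intro det_upper_triangular[of _ N] upper_triangularI) (auto dest: upper_triangularD)
    also have "\<dots> = (\<Prod>i<N. 1 - t * B $$ (i, i))"
      using B by (auto simp: diag_mat_def prod.list_conv_set_nth atLeast0LessThan)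
    finally show ?thesis .
  qed
  moreover have "mat_trace (A ^\<^sub>m k) = (\<Sum>i<N. B $$ (i, i) ^ k)" for k
  proof -
    note W = similar_mat_witD2[OF pow_carrier_mat[OF A, of k] similar_mat_wit_pow[OF wit, of k]]
    have "mat_trace (A ^\<^sub>m k) = mat_trace (P * (B ^\<^sub>m k * Q))"
      using W by (metis assoc_mult_mat)
    also have "\<dots> = mat_trace (B ^\<^sub>m k * Q * P)"
      using W by (intro mat_trace_comm[of _ N N]) auto
    also have "B ^\<^sub>m k * Q * P = B ^\<^sub>m k"
      using W by (metis assoc_mult_mat right_mult_one_mat)
    finally show ?thesis
      using upper_triangular_pow[OF B(1,2), of k] B by (simp add: mat_trace_def)
  qed
  ultimately show thesis by (rule that)
qed

text \<open>
  The logarithmic derivative of \<open>\<Prod>i\<in>I. 1 - l i * X\<close> is minus the sum of the geometric series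
  \<open>l i / (1 - l i * X)\<close>, and the coefficients of this sum are power sums.
\<close>

lemma newton_identity_fps:
  fixes l :: "'i \<Rightarrow> complex"
  assumes "finite I"
  defines "F \<equiv> (\<Prod>i\<in>I. 1 - fps_const (l i) * fps_X)"
  shows "fps_deriv F = - (Abs_fps (\<lambda>k. \<Sum>i\<in>I. l i ^ Suc k) * F)"
  unfolding F_def using \<open>finite I\<close>
proof (induction I rule: finite_induct)
  case empty
  show ?case by (simp add: fps_ext)
next
  case (insert i I)
  let ?f = "1 - fps_const (l i) * fps_X"
  let ?F = "\<Prod>i\<in>I. 1 - fps_const (l i) * fps_X"
  let ?P = "Abs_fps (\<lambda>k. \<Sum>i\<in>I. l i ^ Suc k)"
  let ?Q = "Abs_fps (\<lambda>k. l i ^ Suc k)"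
  have Q: "?f * ?Q = fps_const (l i)"
  proof (rule fps_ext)
    fix k show "fps_nth (?f * ?Q) k = fps_nth (fps_const (l i)) k"
      by (cases k) (simp_all add: left_diff_distrib mult.assoc)
  qed
  have split: "Abs_fps (\<lambda>k. \<Sum>j\<in>insert i I. l j ^ Suc k) = ?Q + ?P"
    using insert.hyps by (intro fps_ext) simp
  have "fps_deriv (?f * ?F) = - fps_const (l i) * ?F + ?f * fps_deriv ?F"
  proof -
    have "fps_deriv ?f = - fps_const (l i)"
      by (simp flip: fps_const_neg)
    then show ?thesis
      by (simp only: fps_deriv_mult add.commute)
  qed
  also have "\<dots> = - (?f * ?Q) * ?F + ?f * - (?P * ?F)"
    unfolding Q insert.IH by simp
  also have "\<dots> = - ((?Q + ?P) * (?f * ?F))"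
  proof -
    have "- (f * Q) * F + f * - (P * F) = - ((Q + P) * (f * F))" for f Q F P :: "complex fps"
      by (simp add: algebra_simps)
    then show ?thesis .
  qed
  finally show ?case
    by (simp only: split prod.insert[OF insert.hyps])
qed

lemma newton_identity_det:
  fixes A :: "complex mat"
  assumes A: "A \<in> carrier_mat N N"
    and q: "\<And>t. det (1\<^sub>m N - t \<cdot>\<^sub>m A) = poly q t"
  shows "coeff q 0 = 1"
    and "of_nat k * coeff q k = - (\<Sum>j=1..k. mat_trace (A ^\<^sub>m j) * coeff q (k - j))"
proof -
  obtain l where l: "\<And>t. det (1\<^sub>m N - t \<cdot>\<^sub>m A) = (\<Prod>i<N. 1 - t * l i)"
    and tr: "\<And>k. mat_trace (A ^\<^sub>m k) = (\<Sum>i<N. l i ^ k)"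
    using complex_mat_eigenvalues[OF A] by blast
  have "poly q = poly (\<Prod>i<N. [:1, - l i:])"
    using q l by (auto simp: poly_prod)
  then have q_eq: "q = (\<Prod>i<N. [:1, - l i:])"
    by (simp add: poly_eq_poly_eq_iff)
  show "coeff q 0 = 1"
    by (simp add: q_eq flip: poly_0_coeff_0) (simp add: poly_prod)
  have F: "fps_of_poly q = (\<Prod>i<N. 1 - fps_const (l i) * fps_X)"
    unfolding q_eq fps_of_poly_prod
    by (intro prod.cong) (simp_all add: fps_of_poly_pCons fps_const_neg[symmetric] mult.commute
      del: fps_const_neg)
  show "of_nat k * coeff q k = - (\<Sum>j=1..k. mat_trace (A ^\<^sub>m j) * coeff q (k - j))"
  proof (cases k)
    case (Suc m)
    have "of_nat k * coeff q k = fps_nth (fps_deriv (fps_of_poly q)) m"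
      by (simp add: Suc)
    also have "\<dots> = - (\<Sum>j=0..m. mat_trace (A ^\<^sub>m Suc j) * coeff q (m - j))"
      unfolding F newton_identity_fps[OF finite_lessThan]
      unfolding F[symmetric] by (simp add: fps_mult_nth tr del: pow_mat.simps)
    also have "\<dots> = - (\<Sum>j=1..k. mat_trace (A ^\<^sub>m j) * coeff q (k - j))"
      unfolding Suc One_nat_def sum.shift_bounds_cl_Suc_ivl by simp
    finally show ?thesis .
  qed simp
qed


section \<open>Comparing coefficients in several variables\<close>

text \<open>
  Polynomial functions that agree everywhere have the same coefficients, so every linear functional on
  polynomials takes the same value on them. A functional is given by its values \<open>\<phi>\<close> on monomials, here
  identified with their exponents, and a polynomial by a family of terms that may repeat a monomial. In
  this form coefficients of polynomials in several variables need no notation of their own.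
\<close>

lemma monomial_identity_transfer:
  fixes c :: "'i \<Rightarrow> complex" and d :: "'j \<Rightarrow> complex"
    and \<phi> :: "('v \<Rightarrow> nat) \<Rightarrow> complex"
  assumes "finite V" "finite I" "finite J"
    and "\<And>u. (\<Sum>i\<in>I. c i * (\<Prod>a\<in>V. u a ^ m i a)) = (\<Sum>j\<in>J. d j * (\<Prod>a\<in>V. u a ^ r j a))"
    and "\<And>f g. (\<And>a. a \<in> V \<Longrightarrow> f a = g a) \<Longrightarrow> \<phi> f = \<phi> g"
  shows "(\<Sum>i\<in>I. c i * \<phi> (m i)) = (\<Sum>j\<in>J. d j * \<phi> (r j))"
  using assms
proof (induction V arbitrary: I J \<phi> rule: finite_induct)
  case empty
  have "\<phi> f = \<phi> (\<lambda>_. 0)" for f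
    by (rule empty.prems(4)) simp
  then have const: "\<phi> = (\<lambda>_. \<phi> (\<lambda>_. 0))" by blast
  show ?case
    using empty.prems(3)
    by (subst (1 2) const) (simp flip: sum_distrib_right)
next
  case (insert b V)
  define K where "K = (\<lambda>i. m i b) ` I \<union> (\<lambda>j. r j b) ` J"
  have "finite K" using insert.prems(1,2) by (simp add: K_def)
  \<comment> \<open>The terms of degree \<open>k\<close> in the variable \<open>b\<close> can be compared separately: for fixed other variables they give the \<open>k\<close>-th coefficient of a polynomial in one variable.\<close>
  have slice: "(\<Sum>i\<in>{i\<in>I. m i b = k}. c i * \<phi> (m i)) = (\<Sum>j\<in>{j\<in>J. r j b = k}. d j * \<phi> (r j))" for k
  proof -
    have "(\<Sum>i\<in>{i\<in>I. m i b = k}. c i * (\<Prod>a\<in>V. u a ^ m i a)) =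
        (\<Sum>j\<in>{j\<in>J. r j b = k}. d j * (\<Prod>a\<in>V. u a ^ r j a))" for u
    proof -
      let ?p = "\<Sum>i\<in>I. monom (c i * (\<Prod>a\<in>V. u a ^ m i a)) (m i b)"
      let ?q = "\<Sum>j\<in>J. monom (d j * (\<Prod>a\<in>V. u a ^ r j a)) (r j b)"
      have upd: "(\<Prod>a\<in>insert b V. (u(b := t)) a ^ e a) = (\<Prod>a\<in>V. u a ^ e a) * t ^ e b" for t and e :: "'v \<Rightarrow> nat"
      proof -
        have "(\<Prod>a\<in>V. (u(b := t)) a ^ e a) = (\<Prod>a\<in>V. u a ^ e a)"
          using insert.hyps by (intro prod.cong) auto
        then show ?thesis using insert.hyps by simp
      qed
      have "poly ?p t = poly ?q t" for t
        using insert.prems(3)[of "u(b := t)"]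
        unfolding upd by (simp add: poly_sum poly_monom mult.assoc)
      then have "?p = ?q"
        by (simp add: fun_eq_iff flip: poly_eq_poly_eq_iff)
      then have "coeff ?p k = coeff ?q k" by simp
      then show ?thesis
        using insert.prems(1,2) by (simp add: coeff_sum sum.inter_filter)
    qed
    then have "(\<Sum>i\<in>{i\<in>I. m i b = k}. c i * \<phi> ((m i)(b := k))) =
        (\<Sum>j\<in>{j\<in>J. r j b = k}. d j * \<phi> ((r j)(b := k)))"
      using insert.prems(1,2)
      by (intro insert.IH[of _ _ "\<lambda>f. \<phi> (f(b := k))"] insert.prems(4)) auto
    moreover have "(\<Sum>i\<in>{i\<in>I. m i b = k}. c i * \<phi> ((m i)(b := k))) =
        (\<Sum>i\<in>{i\<in>I. m i b = k}. c i * \<phi> (m i))"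
      by (intro sum.cong) auto
    moreover have "(\<Sum>j\<in>{j\<in>J. r j b = k}. d j * \<phi> ((r j)(b := k))) =
        (\<Sum>j\<in>{j\<in>J. r j b = k}. d j * \<phi> (r j))"
      by (intro sum.cong) auto
    ultimately show ?thesis by simp
  qed
  have "(\<Sum>i\<in>I. c i * \<phi> (m i)) = (\<Sum>k\<in>K. \<Sum>i\<in>{i\<in>I. m i b = k}. c i * \<phi> (m i))"
    using \<open>finite K\<close> insert.prems(1,2) by (intro sum.group[symmetric]) (auto simp: K_def)
  also have "\<dots> = (\<Sum>k\<in>K. \<Sum>j\<in>{j\<in>J. r j b = k}. d j * \<phi> (r j))"
    by (simp only: slice)
  also have "\<dots> = (\<Sum>j\<in>J. d j * \<phi> (r j))"
    using \<open>finite K\<close> insert.prems(1,2) by (intro sum.group) (auto simp: K_def)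
  finally show ?case .
qed


section \<open>Newton identities for weighted multisets\<close>

definition multisets_of_length :: "'c set \<Rightarrow> ('c \<Rightarrow> nat) \<Rightarrow> nat \<Rightarrow> 'c multiset set" where
  "multisets_of_length X len k = {C. set_mset C \<subseteq> X \<and> (\<Sum>c\<in>#C. len c) = k}"

definition multiset_weight :: "('c \<Rightarrow> complex) \<Rightarrow> 'c multiset \<Rightarrow> complex" where
  "multiset_weight \<alpha> C = (\<Prod>c\<in>#C. \<alpha> c) / of_nat (multi_fact C)"

lemma finite_multisets_of_length:
  assumes pos: "\<And>c. c \<in> X \<Longrightarrow> 0 < len c" and fin: "finite {c\<in>X. len c \<le> k}"
  shows "finite (multisets_of_length X len k)"
proof -
  have "set_mset C \<subseteq> {c\<in>X. len c \<le> k} \<and> size C \<le> k" if C: "C \<in> multisets_of_length X len k" for C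
  proof
    have X: "set_mset C \<subseteq> X" and k: "(\<Sum>c\<in>#C. len c) = k"
      using C by (auto simp: multisets_of_length_def)
    show "set_mset C \<subseteq> {c\<in>X. len c \<le> k}"
    proof
      fix c assume c: "c \<in># C"
      then have "len c \<le> (\<Sum>c\<in>#C. len c)"
        by (metis insert_DiffM le_add1 sum_mset.insert image_mset_add_mset)
      with c X k show "c \<in> {c\<in>X. len c \<le> k}" by auto
    qed
    have "size C = (\<Sum>c\<in>#C. 1)" by simp
    also have "\<dots> \<le> (\<Sum>c\<in>#C. len c)"
      using X pos by (intro sum_mset_mono) (auto simp: Suc_le_eq)
    finally show "size C \<le> k" using k by simp
  qed
  then have "multisets_of_length X len k \<subseteq>
      (\<Union>s\<le>k. {C. set_mset C \<subseteq> {c\<in>X. len c \<le> k} \<and> size C = s})"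
    by blast
  moreover have "finite \<dots>"
    using fin by (intro finite_UN_I) (auto simp flip: multisets_of_size_def)
  ultimately show ?thesis by (rule finite_subset)
qed

lemma multi_fact_add_mset: "multi_fact (add_mset c D) = Suc (count D c) * multi_fact D"
proof (cases "c \<in># D")
  case True
  have "(\<Prod>d\<in>set_mset D - {c}. fact (count (add_mset c D) d)) = (\<Prod>d\<in>set_mset D - {c}. fact (count D d) :: nat)"
    by (intro prod.cong) auto
  with True show ?thesis
    by (simp add: multi_fact_def insert_absorb prod.remove[of _ c] del: mult_Suc)
next
  case False
  have "(\<Prod>d\<in>set_mset D. fact (count (add_mset c D) d)) = (\<Prod>d\<in>set_mset D. fact (count D d) :: nat)"
    using False by (intro prod.cong) auto
  with False show ?thesis
    by (simp add: multi_fact_def not_in_iff)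
qed

lemma multi_fact_nonzero: "multi_fact C \<noteq> 0"
  by (simp add: multi_fact_def)

text \<open>
  The multiplicity cancels one factor of the factorial. Hence summing over the \<open>count C c\<close> copies of \<open>c\<close>
  in \<open>C = add_mset c D\<close> leaves the weight of \<open>D\<close>, without a denominator.
\<close>

lemma multiset_weight_add_mset:
  "of_nat (Suc (count D c)) * multiset_weight \<alpha> (add_mset c D) = \<alpha> c * multiset_weight \<alpha> D"
  using multi_fact_nonzero[of D]
  by (simp add: multiset_weight_def multi_fact_add_mset divide_simps del: of_nat_Suc mult_Suc)

text \<open>
  In a multiset of total length \<open>k\<close> there are \<open>k\<close> ways to mark a step of one of its members. Taking the
  marked member \<open>c\<close>, of length \<open>j\<close>, out of the multiset leaves any multiset of total length \<open>k - j\<close>, and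
  there were \<open>j\<close> ways to choose the marked step within \<open>c\<close>.
\<close>

lemma newton_identity_multisets:
  fixes \<alpha> :: "'c \<Rightarrow> complex"
  assumes pos: "\<And>c. c \<in> X \<Longrightarrow> 0 < len c" and fin: "\<And>k. finite {c\<in>X. len c \<le> k}"
  defines "G \<equiv> \<lambda>k. \<Sum>C\<in>multisets_of_length X len k. multiset_weight \<alpha> C"
  shows "of_nat k * G k = (\<Sum>j=1..k. (\<Sum>c\<in>{c\<in>X. len c = j}. of_nat j * \<alpha> c) * G (k - j))"
proof -
  let ?M = "multisets_of_length X len"
  let ?Xk = "{c\<in>X. len c \<le> k}"
  have finM: "finite (?M i)" for i
    using finite_multisets_of_length[OF pos fin] by blast
  have len_sum: "(\<Sum>c\<in>#C. len c) = (\<Sum>c\<in>set_mset C. count C c * len c)" for C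
  proof -
    have "(\<Sum>c\<in>#C. len c) = (\<Sum>c\<in>A. count C c * len c)" if "finite A" "set_mset C \<subseteq> A" for A
      using that(2)
    proof (induction C)
      case (add c C)
      have "(\<Sum>a\<in>A. count (add_mset c C) a * len a) =
          (\<Sum>a\<in>A. count C a * len a + (if a = c then len a else 0))"
        by (intro sum.cong) auto
      then show ?case
        using add \<open>finite A\<close> by (simp add: sum.distrib)
    qed simp
    then show ?thesis by blast
  qed
  have "of_nat k * G k = (\<Sum>C\<in>?M k. \<Sum>c\<in>set_mset C. of_nat (count C c * len c) * multiset_weight \<alpha> C)"
    unfolding G_def sum_distrib_left
    by (intro sum.cong refl)
      (simp add: multisets_of_length_def len_sum flip: sum_distrib_right of_nat_sum of_nat_mult)
  also have "\<dots> = (\<Sum>(C, c)\<in>Sigma (?M k) set_mset. of_nat (count C c * len c) * multiset_weight \<alpha> C)"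
    using finM by (intro sum.Sigma) auto
  also have "\<dots> = (\<Sum>(c, D)\<in>Sigma ?Xk (\<lambda>c. ?M (k - len c)). of_nat (len c) * (\<alpha> c * multiset_weight \<alpha> D))"
  proof (rule sum.reindex_bij_witness[of _ "\<lambda>(c, D). (add_mset c D, c)" "\<lambda>(C, c). (c, C - {#c#})"])
    fix p assume "p \<in> Sigma (?M k) set_mset"
    then obtain C c where p: "p = (C, c)" "c \<in># C" "set_mset C \<subseteq> X" "(\<Sum>c\<in>#C. len c) = k"
      by (auto simp: multisets_of_length_def)
    obtain D where C: "C = add_mset c D"
      using p(2) by (metis insert_DiffM)
    show "(case case p of (C, c) \<Rightarrow> (c, C - {#c#}) of (c, D) \<Rightarrow> (add_mset c D, c)) = p"
      using p by simp
    show "(case p of (C, c) \<Rightarrow> (c, C - {#c#})) \<in> Sigma ?Xk (\<lambda>c. ?M (k - len c))"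
      using p C by (auto simp: multisets_of_length_def)
    have "of_nat (len c) * (\<alpha> c * multiset_weight \<alpha> D) =
        of_nat (count C c * len c) * multiset_weight \<alpha> C"
      unfolding multiset_weight_add_mset[symmetric] C count_add_mset
      by (simp only: of_nat_mult mult_ac if_True simp_thms)
    then show "(case case p of (C, c) \<Rightarrow> (c, C - {#c#}) of
        (c, D) \<Rightarrow> of_nat (len c) * (\<alpha> c * multiset_weight \<alpha> D)) =
        (case p of (C, c) \<Rightarrow> of_nat (count C c * len c) * multiset_weight \<alpha> C)"
      using p(1) C by (simp add: algebra_simps)
  qed (auto simp: multisets_of_length_def)
  also have "\<dots> = (\<Sum>c\<in>?Xk. of_nat (len c) * \<alpha> c * G (k - len c))"
    using fin[of k] finM
    by (subst sum.Sigma[symmetric]) (simp_all add: G_def sum_distrib_left mult.assoc)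
  also have "\<dots> = (\<Sum>j=1..k. \<Sum>c\<in>{c\<in>?Xk. len c = j}. of_nat (len c) * \<alpha> c * G (k - len c))"
    using fin[of k] pos by (intro sum.group[symmetric]) (auto simp: Suc_le_eq)
  also have "\<dots> = (\<Sum>j=1..k. (\<Sum>c\<in>{c\<in>X. len c = j}. of_nat j * \<alpha> c) * G (k - j))"
    unfolding sum_distrib_right by (intro sum.cong) auto
  finally show ?thesis .
qed

lemma multisets_of_length_0:
  assumes "\<And>c. c \<in> X \<Longrightarrow> 0 < len c"
  shows "multisets_of_length X len 0 = {{#}}"
proof -
  have "C = {#}" if "C \<in> multisets_of_length X len 0" for C
    using that assms by (cases C) (fastforce simp: multisets_of_length_def)+
  then show ?thesis
    by (auto simp: multisets_of_length_def)
qed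


section \<open>Rotation classes of closed walks\<close>

text \<open>
  Orbit and stabiliser of a list under the action of \<open>\<int>/n\<close> by rotation, where \<open>n\<close> is its length.
\<close>

lemma card_rotations:
  assumes "es \<noteq> []"
  shows "card {fs. \<exists>k. fs = rotate k es} * walk_val es = length es"
proof -
  let ?n = "length es"
  let ?O = "{fs. \<exists>k. fs = rotate k es}"
  have n: "0 < ?n" using assms by simp
  have O: "?O = (\<lambda>k. rotate k es) ` {..<?n}"
  proof (intro equalityI subsetI)
    fix fs assume "fs \<in> ?O"
    then obtain k where "fs = rotate k es" by blast
    then have "fs = rotate (k mod ?n) es" by (simp add: rotate_conv_mod[of k])
    with n show "fs \<in> (\<lambda>k. rotate k es) ` {..<?n}" by auto
  qed auto
  have fibre: "card {k\<in>{..<?n}. rotate k es = fs} = walk_val es" if fs: "fs \<in> ?O" for fs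
  proof -
    obtain r where r: "r < ?n" "fs = rotate r es"
      using fs unfolding O by auto
    have shift_inv: "((k + r) mod ?n + (?n - r)) mod ?n = k" if "k < ?n" for k
    proof -
      have "((k + r) mod ?n + (?n - r)) mod ?n = (k + r + (?n - r)) mod ?n"
        by (simp add: mod_add_left_eq)
      also have "k + r + (?n - r) = k + ?n" using r by simp
      finally show ?thesis using that by simp
    qed
    have inv_shift: "((k + (?n - r)) mod ?n + r) mod ?n = k" if "k < ?n" for k
    proof -
      have "((k + (?n - r)) mod ?n + r) mod ?n = (k + (?n - r) + r) mod ?n"
        by (simp add: mod_add_left_eq)
      also have "k + (?n - r) + r = k + ?n" using r by simp
      finally show ?thesis using that by simp
    qed
    \<comment> \<open>The rotations that take \<open>es\<close> to \<open>fs\<close> form a coset of the stabiliser of \<open>es\<close>.\<close>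
    have "bij_betw (\<lambda>k. (k + r) mod ?n) {k. k < ?n \<and> rotate k es = es} {k\<in>{..<?n}. rotate k es = fs}"
    proof (rule bij_betw_byWitness[where f' = "\<lambda>k. (k + (?n - r)) mod ?n"])
      show "(\<lambda>k. (k + r) mod ?n) ` {k. k < ?n \<and> rotate k es = es} \<subseteq> {k\<in>{..<?n}. rotate k es = fs}"
      proof (rule image_subsetI)
        fix k assume "k \<in> {k. k < ?n \<and> rotate k es = es}"
        then have "rotate ((k + r) mod ?n) es = fs"
          unfolding rotate_conv_mod[of "k + r", symmetric] r(2)
          by (simp add: add.commute[of k] flip: rotate_rotate)
        with n show "(k + r) mod ?n \<in> {k\<in>{..<?n}. rotate k es = fs}" by simp
      qed
      show "(\<lambda>k. (k + (?n - r)) mod ?n) ` {k\<in>{..<?n}. rotate k es = fs} \<subseteq> {k. k < ?n \<and> rotate k es = es}"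
      proof (rule image_subsetI)
        fix k assume k: "k \<in> {k\<in>{..<?n}. rotate k es = fs}"
        have "rotate ((k + (?n - r)) mod ?n) es = rotate (?n - r) (rotate k es)"
          unfolding rotate_conv_mod[of "k + (?n - r)", symmetric]
          by (simp add: rotate_rotate add.commute)
        also have "\<dots> = rotate (?n - r + r) es"
          using k r by (simp only: rotate_rotate mem_Collect_eq simp_thms)
        also have "\<dots> = es" using r by simp
        finally show "(k + (?n - r)) mod ?n \<in> {k. k < ?n \<and> rotate k es = es}" using n by simp
      qed
    qed (use shift_inv inv_shift in auto)
    then show ?thesis
      by (simp add: walk_val_def bij_betw_same_card)
  qed
  have fin: "finite ?O" unfolding O by simp
  have "?n = (\<Sum>fs\<in>?O. card {k\<in>{..<?n}. rotate k es = fs})"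
  proof -
    have "(\<Sum>fs\<in>?O. \<Sum>k\<in>{k\<in>{..<?n}. rotate k es = fs}. 1) = (\<Sum>k\<in>{..<?n}. (1 :: nat))"
      using fin by (intro sum.group) auto
    then show ?thesis by simp
  qed
  also have "\<dots> = card ?O * walk_val es"
    using fibre by simp
  finally show ?thesis ..
qed

context fin_digraph
begin

lemma cycle_eq_rotations:
  assumes "c \<in> cycles G"
  shows "c = {fs. \<exists>k. fs = rotate k (representative c)}"
proof -
  have "c \<in> UNIV // cyclic_perm_rel"
    using assms by (auto simp: cycles_def quotient_def)
  then have "c = cyclic_perm_rel `` {representative c}"
    using representative_cycle(1)[OF wf_digraph assms] equiv_cyclic_perm_rel
    by (metis Image_singleton_iff equiv_class_eq_iff quotientE)
  then show ?thesis
    by (auto simp: cyclic_perm_rel_def)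
qed

lemma finite_closed_walks: "finite {es. closed_w es \<and> length es = k}"
proof (rule finite_subset)
  show "{es. closed_w es \<and> length es = k} \<subseteq> {es. set es \<subseteq> arcs G \<and> length es = k}"
    by (auto simp: closed_w_def awalk_def)
qed (rule finite_lists_length_eq[OF finite_arcs])

lemma cyclic_class_eq_iff:
  assumes "c \<in> cycles G"
  shows "cyclic_perm_rel `` {es} = c \<longleftrightarrow> es \<in> c"
proof -
  have "c \<in> UNIV // cyclic_perm_rel"
    using assms by (auto simp: cycles_def quotient_def)
  then show ?thesis
    using equiv_cyclic_perm_rel
    by (metis Image_singleton_iff UNIV_I equiv_class_eq equiv_class_self quotientE)
qed

lemma cycle_member:
  assumes "c \<in> cycles G" "es \<in> c"
  shows "closed_w es" "length es = length (representative c)"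
proof -
  obtain k where "es = rotate k (representative c)"
    using assms(2) cycle_eq_rotations[OF assms(1)] by blast
  then show "closed_w es" "length es = length (representative c)"
    using closed_w_rotate[OF wf_digraph representative_cycle(2)[OF wf_digraph assms(1)]] by auto
qed

lemma finite_cycles_of_length: "finite {c\<in>cycles G. length (representative c) \<le> k}"
proof (rule finite_subset)
  show "{c\<in>cycles G. length (representative c) \<le> k} \<subseteq>
      (\<lambda>es. cyclic_perm_rel `` {es}) ` {es. set es \<subseteq> arcs G \<and> length es \<le> k}"
  proof
    fix c assume c: "c \<in> {c\<in>cycles G. length (representative c) \<le> k}"
    then have "representative c \<in> c" "closed_w (representative c)"
      using representative_cycle[OF wf_digraph] by auto
    then have "c = cyclic_perm_rel `` {representative c}" "set (representative c) \<subseteq> arcs G"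
      using c cyclic_class_eq_iff by (auto simp: closed_w_def awalk_def)
    with c show "c \<in> (\<lambda>es. cyclic_perm_rel `` {es}) ` {es. set es \<subseteq> arcs G \<and> length es \<le> k}"
      by blast
  qed
qed (intro finite_imageI finite_lists_length_le finite_arcs)

text \<open>
  A cycle of length \<open>k\<close> consists of \<open>k / cycle_val c\<close> different closed walks, one for each essentially
  different starting point. The valuation in the denominator of the weight of a cycle turns sums over
  cycles into sums over closed walks.
\<close>

lemma sum_cycles_of_length:
  fixes g :: "'b list \<Rightarrow> complex"
  assumes inv: "\<And>es k. closed_w es \<Longrightarrow> g (rotate k es) = g es"
  shows "(\<Sum>c\<in>{c\<in>cycles G. length (representative c) = k}.
            of_nat k * (g (representative c) / of_nat (cycle_val c))) =
         (\<Sum>es | closed_w es \<and> length es = k. g es)"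
    (is "(\<Sum>c\<in>?X. _) = (\<Sum>es\<in>?W. _)")
proof -
  have finX: "finite ?X"
    by (rule finite_subset[OF _ finite_cycles_of_length[of k]]) auto
  have "(\<Sum>es\<in>?W. g es) = (\<Sum>c\<in>?X. \<Sum>es\<in>{es\<in>?W. cyclic_perm_rel `` {es} = c}. g es)"
  proof (rule sum.group[symmetric, OF finite_closed_walks finX], rule image_subsetI)
    fix es assume es: "es \<in> ?W"
    let ?c = "cyclic_perm_rel `` {es}"
    have "?c \<in> cycles G" using es by (auto simp: cycles_def quotient_def)
    moreover have "es \<in> ?c" using equiv_cyclic_perm_rel by (auto simp: equiv_def refl_on_def)
    ultimately show "?c \<in> ?X" using cycle_member[of ?c es] es by simp
  qed
  also have "\<dots> = (\<Sum>c\<in>?X. of_nat k * (g (representative c) / of_nat (cycle_val c)))"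
  proof (rule sum.cong[OF refl])
    fix c assume c: "c \<in> ?X"
    let ?r = "representative c"
    have r: "closed_w ?r" "?r \<noteq> []"
      using c representative_cycle(2)[OF wf_digraph] by (auto simp: closed_w_def)
    have "{es\<in>?W. cyclic_perm_rel `` {es} = c} = c"
      using c cyclic_class_eq_iff cycle_member by auto
    moreover have "g es = g ?r" if "es \<in> c" for es
    proof -
      obtain m where "es = rotate m ?r"
        using \<open>es \<in> c\<close> cycle_eq_rotations[of c] c by blast
      then show ?thesis using inv[OF r(1)] by simp
    qed
    ultimately have "(\<Sum>es\<in>{es\<in>?W. cyclic_perm_rel `` {es} = c}. g es) = (\<Sum>es\<in>c. g ?r)"
      by simp
    also have "\<dots> = of_nat (card c) * g ?r" by simp
    also have card: "card c * cycle_val c = k"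
      using card_rotations[OF r(2)] cycle_eq_rotations[of c] c by (simp add: cycle_val_def)
    have "cycle_val c \<noteq> 0"
      using card c r(2) by (metis (mono_tags) length_0_conv mem_Collect_eq mult_0_right)
    then have "of_nat (card c) * g ?r = of_nat k * (g ?r / of_nat (cycle_val c))"
      unfolding card[symmetric] by simp
    finally show "(\<Sum>es\<in>{es\<in>?W. cyclic_perm_rel `` {es} = c}. g es) =
        of_nat k * (g ?r / of_nat (cycle_val c))" .
  qed
  finally show ?thesis ..
qed

end

lemma walk_visits_Cons:
  "walk_visits G a (e # es) = (if tail G e = a then 1 else 0) + walk_visits G a es"
proof -
  have "walk_visits G a es = length (filter (\<lambda>e. tail G e = a) es)" for es
    by (simp add: walk_visits_def length_filter_conv_card)
  then show ?thesis by simp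
qed

text \<open>
  A variable \<open>u a\<close> attached to the edges that leave \<open>a\<close> counts the visits to \<open>a\<close>.
\<close>

lemma walk_weight_scale_tail:
  assumes "wf_digraph G" "finite (verts G)" "set es \<subseteq> arcs G"
  shows "walk_weight (\<lambda>e. u (tail G e) * x e) es =
    (\<Prod>a\<in>verts G. u a ^ walk_visits G a es) * walk_weight x es"
  using assms(3)
proof (induction es)
  case Nil
  show ?case by (simp add: walk_weight_def walk_visits_def)
next
  case (Cons e es)
  then have "tail G e \<in> verts G"
    using assms(1) by (simp add: wf_digraph.tail_in_verts)
  then have "(\<Prod>a\<in>verts G. u a ^ walk_visits G a (e # es)) =
      u (tail G e) * (\<Prod>a\<in>verts G. u a ^ walk_visits G a es)"
  proof -
    have "(\<Prod>a\<in>verts G. u a ^ (if tail G e = a then 1 else 0)) =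
        (\<Prod>a\<in>verts G. if tail G e = a then u a else 1)"
      by (intro prod.cong) auto
    also have "\<dots> = u (tail G e)"
      using assms(2) \<open>tail G e \<in> verts G\<close> by simp
    finally show ?thesis
      by (simp only: walk_visits_Cons power_add prod.distrib)
  qed
  then show ?case
    using Cons by (simp add: walk_weight_def)
qed


section \<open>The matrix of the twisted Laplacian\<close>

locale twisted_quiver = fin_digraph G
  for G :: "('a :: linorder, 'b) pre_digraph" +
  fixes n :: "'a \<Rightarrow> nat" and U :: "'b \<Rightarrow> complex mat"
  assumes U: "e \<in> arcs G \<Longrightarrow> U e \<in> carrier_mat (n (tail G e)) (n (head G e))"
begin

abbreviation label :: "nat \<Rightarrow> 'a \<times> nat" where
  "label k \<equiv> basis_index G n ! k"

definition dimension :: nat where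
  "dimension = length (basis_index G n)"

lemma set_basis_index: "set (basis_index G n) = Sigma (verts G) (\<lambda>v. {..<n v})"
  by (auto simp: basis_index_def)

lemma distinct_basis_index: "distinct (basis_index G n)"
proof -
  have "distinct (concat (map (\<lambda>v. map (Pair v) [0..<n v]) vs))" if "distinct vs" for vs :: "'a list"
    using that by (induction vs) (auto simp: distinct_map inj_on_def)
  then show ?thesis by (simp add: basis_index_def)
qed

lemma bij_betw_label: "bij_betw label {..<dimension} (Sigma (verts G) (\<lambda>v. {..<n v}))"
  using bij_betw_nth[OF distinct_basis_index refl set_basis_index[symmetric]]
  by (simp add: dimension_def)

lemma label_in: "k < dimension \<Longrightarrow> fst (label k) \<in> verts G \<and> snd (label k) < n (fst (label k))"
  using bij_betw_apply[OF bij_betw_label, of k] by (auto simp: mem_Sigma_iff split_beta)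

lemma label_eq_iff: "j < dimension \<Longrightarrow> k < dimension \<Longrightarrow> label j = label k \<longleftrightarrow> j = k"
  using nth_eq_iff_index_eq[OF distinct_basis_index] by (simp add: dimension_def)

lemma sum_label:
  fixes f :: "'a \<times> nat \<Rightarrow> 'c :: comm_monoid_add"
  shows "(\<Sum>k<dimension. f (label k)) = (\<Sum>v\<in>verts G. \<Sum>i<n v. f (v, i))"
  using sum.reindex_bij_betw[OF bij_betw_label, of f] by (simp add: sum.Sigma)

lemma card_label:
  assumes "a \<in> verts G"
  shows "card {k\<in>{0..<dimension}. fst (label k) = a} = n a"
proof -
  have "card {k\<in>{0..<dimension}. fst (label k) = a} = (\<Sum>k<dimension. if fst (label k) = a then 1 else 0)"
    by (simp add: sum.If_cases atLeast0LessThan Int_def)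
  also have "\<dots> = (\<Sum>v\<in>verts G. \<Sum>i<n v. if v = a then 1 else 0)"
    using sum_label[of "\<lambda>l. if fst l = a then 1 else 0 :: nat"] by simp
  also have "\<dots> = (\<Sum>v\<in>verts G. if v = a then n v else 0)"
    by (intro sum.cong) auto
  finally show ?thesis using assms by simp
qed

definition weighted_adjacency :: "('b \<Rightarrow> complex) \<Rightarrow> complex mat" where
  "weighted_adjacency x = mat dimension dimension (\<lambda>(j, k).
     \<Sum>e\<in>{e\<in>out_arcs G (fst (label j)). head G e = fst (label k)}.
       x e * U e $$ (snd (label j), snd (label k)))"

lemma weighted_adjacency_carrier: "weighted_adjacency x \<in> carrier_mat dimension dimension"
  by (simp add: weighted_adjacency_def)

text \<open>
  On the matrix side the same variables scale rows, and so count the rows chosen in each block.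
\<close>

lemma weighted_adjacency_scale_tail:
  assumes "j < dimension" "k < dimension"
  shows "weighted_adjacency (\<lambda>e. u (tail G e) * x e) $$ (j, k) =
    u (fst (label j)) * weighted_adjacency x $$ (j, k)"
  using assms by (simp add: weighted_adjacency_def sum_distrib_left mult.assoc)

text \<open>
  The factor \<open>1\<close> makes the right-hand side an instance of \<open>det_diag_minus_row_scaled\<close>.
\<close>

lemma direct_sum_matrix_twisted_laplacian:
  "direct_sum_matrix G n (twisted_laplacian G n x U) =
    mat dimension dimension (\<lambda>(j, k).
      (if j = k then out_weight G x (fst (label j)) else 0) - 1 * weighted_adjacency x $$ (j, k))"
proof (rule eq_matI)
  fix j k
  assume "j < dim_row (mat dimension dimension (\<lambda>(j, k).
      (if j = k then out_weight G x (fst (label j)) else 0) - 1 * weighted_adjacency x $$ (j, k)))"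
    and "k < dim_col (mat dimension dimension (\<lambda>(j, k).
      (if j = k then out_weight G x (fst (label j)) else 0) - 1 * weighted_adjacency x $$ (j, k)))"
  then have jk: "j < dimension" "k < dimension" by auto
  obtain v i w l where j: "label j = (v, i)" and k: "label k = (w, l)"
    by (metis surj_pair)
  have i: "v \<in> verts G" "i < n v" and l: "w \<in> verts G" "l < n w"
    using label_in[OF jk(1)] label_in[OF jk(2)] j k by auto
  define f where "f = basis_vector n (w, l)"
  have f: "f u \<in> carrier_vec (n u)" for u
    by (simp add: f_def basis_vector_def)
  have fv: "f v $ i = (if (v, i) = (w, l) then 1 else 0)"
    using i l by (auto simp: f_def basis_vector_def)
  have Uf: "(U e *\<^sub>v f (head G e)) $ i = (if head G e = w then U e $$ (i, l) else 0)"
    if e: "e \<in> out_arcs G v" for e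
  proof -
    have "U e \<in> carrier_mat (n v) (n (head G e))" using U[of e] e by simp
    then show ?thesis using i l by (auto simp: f_def basis_vector_def)
  qed
  have carrier: "x e \<cdot>\<^sub>v (f (tail G e) - U e *\<^sub>v f (head G e)) \<in> carrier_vec (n v)"
    if "e \<in> out_arcs G v" for e
    using that U[of e] f[of "tail G e"] f[of "head G e"] by auto
  have "direct_sum_matrix G n (twisted_laplacian G n x U) $$ (j, k) = twisted_laplacian G n x U f v $ i"
    using jk j k by (simp add: direct_sum_matrix_def Let_def f_def flip: dimension_def)
  also have "\<dots> = (\<Sum>e\<in>out_arcs G v. (x e \<cdot>\<^sub>v (f (tail G e) - U e *\<^sub>v f (head G e))) $ i)"
    unfolding twisted_laplacian_def using i carrier by (intro index_finsum_vec) auto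
  also have "\<dots> = (\<Sum>e\<in>out_arcs G v. x e * (if (v, i) = (w, l) then 1 else 0) -
      (if head G e = w then x e * U e $$ (i, l) else 0))"
  proof (rule sum.cong[OF refl])
    fix e assume e: "e \<in> out_arcs G v"
    have "f (tail G e) \<in> carrier_vec (n v)" "U e *\<^sub>v f (head G e) \<in> carrier_vec (n v)"
      using e U[of e] f[of "tail G e"] f[of "head G e"] by auto
    moreover have "(r \<cdot>\<^sub>v (g - h)) $ i = r * (g $ i - h $ i)"
      if "g \<in> carrier_vec (n v)" "h \<in> carrier_vec (n v)" for r :: complex and g h
      using that i by simp
    ultimately have "(x e \<cdot>\<^sub>v (f (tail G e) - U e *\<^sub>v f (head G e))) $ i =
        x e * (f (tail G e) $ i - (U e *\<^sub>v f (head G e)) $ i)"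
      by blast
    then show "(x e \<cdot>\<^sub>v (f (tail G e) - U e *\<^sub>v f (head G e))) $ i =
        x e * (if (v, i) = (w, l) then 1 else 0) - (if head G e = w then x e * U e $$ (i, l) else 0)"
      unfolding Uf[OF e] using e fv by (simp add: right_diff_distrib)
  qed
  also have "\<dots> = (if (v, i) = (w, l) then out_weight G x v else 0) -
      (\<Sum>e\<in>{e\<in>out_arcs G v. head G e = w}. x e * U e $$ (i, l))"
    by (subst sum.inter_filter) (simp_all add: sum_subtractf out_weight_def finite_out_arcs)
  also have "\<dots> = mat dimension dimension (\<lambda>(j, k).
      (if j = k then out_weight G x (fst (label j)) else 0) - 1 * weighted_adjacency x $$ (j, k)) $$ (j, k)"
    using jk j k label_eq_iff[OF jk] by (auto simp: weighted_adjacency_def)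
  finally show "direct_sum_matrix G n (twisted_laplacian G n x U) $$ (j, k) =
    mat dimension dimension (\<lambda>(j, k).
      (if j = k then out_weight G x (fst (label j)) else 0) - 1 * weighted_adjacency x $$ (j, k)) $$ (j, k)" .
qed (simp_all add: direct_sum_matrix_def Let_def dimension_def)


section \<open>Powers of the weighted adjacency matrix\<close>

lemma pow_mat_Suc_left:
  fixes A :: "'c :: semiring_1 mat"
  assumes A: "A \<in> carrier_mat N N"
  shows "A ^\<^sub>m Suc m = A * A ^\<^sub>m m"
proof (induction m)
  case 0
  show ?case using A by simp
next
  case (Suc m)
  have "A ^\<^sub>m Suc (Suc m) = (A * A ^\<^sub>m m) * A"
    using Suc by simp
  also have "\<dots> = A * A ^\<^sub>m Suc m"
    using A by (simp add: assoc_mult_mat[of _ N N _ N _ N])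
  finally show ?case .
qed

abbreviation hol_to :: "'a \<Rightarrow> 'b list \<Rightarrow> complex mat" where
  "hol_to w es \<equiv> foldr (\<lambda>e A. U e * A) es (1\<^sub>m (n w))"

lemma hol_to_carrier: "awalk v es w \<Longrightarrow> hol_to w es \<in> carrier_mat (n v) (n w)"
  by (rule foldr_mat_mult_append(1)[OF wf_digraph U _ one_carrier_mat])

lemma finite_walks: "finite {es. awalk v es w \<and> length es = m}"
  by (rule finite_subset[OF _ finite_lists_length_eq[OF finite_arcs, of m]]) (auto simp: awalk_def)

lemma sum_walks_Suc:
  fixes g :: "'b list \<Rightarrow> complex"
  shows "(\<Sum>es | awalk v es w \<and> length es = Suc m. g es) =
    (\<Sum>e\<in>out_arcs G v. \<Sum>es | awalk (head G e) es w \<and> length es = m. g (e # es))"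
proof -
  let ?W = "\<lambda>e. {es. awalk (head G e) es w \<and> length es = m}"
  have "(\<Sum>es | awalk v es w \<and> length es = Suc m. g es) =
      (\<Sum>(e, es)\<in>Sigma (out_arcs G v) ?W. g (e # es))"
  proof (rule sum.reindex_bij_witness[of _ "\<lambda>(e, es). e # es" "\<lambda>es. (hd es, tl es)"])
    fix es assume "es \<in> {es. awalk v es w \<and> length es = Suc m}"
    then obtain e fs where es: "es = e # fs" "awalk v (e # fs) w" "length fs = m"
      by (cases es) auto
    then show "(case (hd es, tl es) of (e, es) \<Rightarrow> e # es) = es"
      and "(hd es, tl es) \<in> Sigma (out_arcs G v) ?W"
      and "(case (hd es, tl es) of (e, es) \<Rightarrow> g (e # es)) = g es"
      by (auto simp: awalk_Cons_iff)
  qed (auto simp: awalk_Cons_iff)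
  also have "\<dots> = (\<Sum>e\<in>out_arcs G v. \<Sum>es\<in>?W e. g (e # es))"
    by (intro sum.Sigma[symmetric] finite_out_arcs ballI finite_walks)
  finally show ?thesis .
qed

lemma weighted_adjacency_pow:
  assumes "j < dimension" "k < dimension"
  shows "(weighted_adjacency x ^\<^sub>m m) $$ (j, k) =
    (\<Sum>es | awalk (fst (label j)) es (fst (label k)) \<and> length es = m.
       walk_weight x es * hol_to (fst (label k)) es $$ (snd (label j), snd (label k)))"
  using assms(1)
proof (induction m arbitrary: j)
  case 0
  obtain v i where j: "label j = (v, i)" by (metis surj_pair)
  obtain w l where k: "label k = (w, l)" by (metis surj_pair)
  have vi: "v \<in> verts G" "i < n v" "l < n w"
    using label_in[OF 0] label_in[OF assms(2)] j k by auto
  have "{es. awalk v es w \<and> length es = 0} = (if v = w then {[]} else {})"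
    using vi(1) by (auto simp: awalk_Nil_iff)
  then have "(\<Sum>es | awalk v es w \<and> length es = 0. walk_weight x es * hol_to w es $$ (i, l)) =
      (if (v, i) = (w, l) then 1 else 0)"
    using vi by (cases "v = w") (simp_all add: walk_weight_def)
  moreover have "(weighted_adjacency x ^\<^sub>m 0) $$ (j, k) = (if j = k then 1 else 0)"
    using 0 assms(2) by (simp add: weighted_adjacency_def)
  ultimately show ?case
    using label_eq_iff[OF 0 assms(2)] by (simp only: j k fst_conv snd_conv)
next
  case (Suc m)
  let ?A = "weighted_adjacency x"
  obtain v i where j: "label j = (v, i)" by (metis surj_pair)
  obtain w l where k: "label k = (w, l)" by (metis surj_pair)
  have i: "i < n v" and l: "l < n w"
    using label_in[OF Suc.prems] label_in[OF assms(2)] j k by auto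
  let ?W = "\<lambda>v. {es. awalk v es w \<and> length es = m}"
  define S where "S v i = (\<Sum>es\<in>?W v. walk_weight x es * hol_to w es $$ (i, l))" for v i
  have "(?A ^\<^sub>m Suc m) $$ (j, k) = (\<Sum>r<dimension. ?A $$ (j, r) * (?A ^\<^sub>m m) $$ (r, k))"
    unfolding pow_mat_Suc_left[OF weighted_adjacency_carrier]
    using weighted_adjacency_carrier[of x] Suc.prems assms(2)
    by (simp add: scalar_prod_def atLeast0LessThan)
  also have "\<dots> = (\<Sum>r<dimension. case label r of (w', i') \<Rightarrow>
      (\<Sum>e\<in>{e\<in>out_arcs G v. head G e = w'}. x e * U e $$ (i, i')) * S w' i')"
    using Suc.IH Suc.prems j k
    by (intro sum.cong) (simp_all add: weighted_adjacency_def S_def split_beta)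
  also have "\<dots> = (\<Sum>w'\<in>verts G. \<Sum>i'<n w'.
      (\<Sum>e\<in>{e\<in>out_arcs G v. head G e = w'}. x e * U e $$ (i, i')) * S w' i')"
    by (subst sum_label) simp
  also have "\<dots> = (\<Sum>w'\<in>verts G. \<Sum>e\<in>{e\<in>out_arcs G v. head G e = w'}.
      \<Sum>i'<n (head G e). x e * U e $$ (i, i') * S (head G e) i')"
    unfolding sum_distrib_right by (intro sum.cong refl, subst sum.swap) (auto intro!: sum.cong)
  also have "\<dots> = (\<Sum>e\<in>out_arcs G v. \<Sum>i'<n (head G e). x e * U e $$ (i, i') * S (head G e) i')"
    by (intro sum.group) (auto intro: finite_out_arcs)
  also have "\<dots> = (\<Sum>e\<in>out_arcs G v. \<Sum>es\<in>?W (head G e).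
      walk_weight x (e # es) * hol_to w (e # es) $$ (i, l))"
  proof (rule sum.cong[OF refl])
    fix e assume e: "e \<in> out_arcs G v"
    have prod: "hol_to w (e # es) $$ (i, l) = (\<Sum>i'<n (head G e). U e $$ (i, i') * hol_to w es $$ (i', l))"
      if "es \<in> ?W (head G e)" for es
      using that U[of e] hol_to_carrier[of "head G e" es w] e i l
      by (simp add: scalar_prod_def atLeast0LessThan)
    have "(\<Sum>i'<n (head G e). x e * U e $$ (i, i') * S (head G e) i') =
        (\<Sum>es\<in>?W (head G e). \<Sum>i'<n (head G e).
          x e * U e $$ (i, i') * (walk_weight x es * hol_to w es $$ (i', l)))"
      unfolding S_def sum_distrib_left by (rule sum.swap)
    also have "\<dots> = (\<Sum>es\<in>?W (head G e). walk_weight x (e # es) * hol_to w (e # es) $$ (i, l))"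
      using prod by (intro sum.cong) (simp_all add: walk_weight_def sum_distrib_left mult_ac)
    finally show "(\<Sum>i'<n (head G e). x e * U e $$ (i, i') * S (head G e) i') = \<dots>" .
  qed
  also have "\<dots> = (\<Sum>es | awalk v es w \<and> length es = Suc m. walk_weight x es * hol_to w es $$ (i, l))"
    by (rule sum_walks_Suc[symmetric])
  finally show ?case by (simp only: j k fst_conv snd_conv)
qed

lemma head_last_awalk: "awalk v es w \<Longrightarrow> es \<noteq> [] \<Longrightarrow> head G (last es) = w"
  by (induction es arbitrary: v) (auto simp: awalk_Cons_iff awalk_Nil_iff)

text \<open>
  A diagonal block of \<open>A ^\<^sub>m m\<close> sums the holonomies of the closed walks based at its vertex. The
  restriction to \<open>1 \<le> m\<close> is essential: the trace of \<open>A ^\<^sub>m 0\<close> is \<open>dimension\<close>, but closed walks are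
  nonempty.
\<close>

lemma trace_weighted_adjacency_pow:
  assumes "1 \<le> m"
  shows "mat_trace (weighted_adjacency x ^\<^sub>m m) =
    (\<Sum>es | closed_w es \<and> length es = m. walk_weight x es * mat_trace (walk_hol G n U es))"
proof -
  let ?W = "\<lambda>v. {es. awalk v es v \<and> length es = m}"
  have "mat_trace (weighted_adjacency x ^\<^sub>m m) = (\<Sum>k<dimension. case label k of (v, i) \<Rightarrow>
      \<Sum>es\<in>?W v. walk_weight x es * hol_to v es $$ (i, i))"
    using weighted_adjacency_carrier[of x]
    by (simp add: mat_trace_def weighted_adjacency_pow split_beta)
  also have "\<dots> = (\<Sum>v\<in>verts G. \<Sum>i<n v. \<Sum>es\<in>?W v. walk_weight x es * hol_to v es $$ (i, i))"
    by (subst sum_label) simp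
  also have "\<dots> = (\<Sum>v\<in>verts G. \<Sum>es\<in>?W v. walk_weight x es * mat_trace (walk_hol G n U es))"
  proof (rule sum.cong[OF refl])
    fix v
    have "(\<Sum>i<n v. walk_weight x es * hol_to v es $$ (i, i)) =
        walk_weight x es * mat_trace (walk_hol G n U es)" if "es \<in> ?W v" for es
    proof -
      have es: "awalk v es v" "es \<noteq> []" using that assms by auto
      show ?thesis
        using hol_to_carrier[OF es(1)]
        by (simp add: walk_hol_def head_last_awalk[OF es] mat_trace_def sum_distrib_left)
    qed
    then show "(\<Sum>i<n v. \<Sum>es\<in>?W v. walk_weight x es * hol_to v es $$ (i, i)) =
        (\<Sum>es\<in>?W v. walk_weight x es * mat_trace (walk_hol G n U es))"
      by (subst sum.swap) simp
  qed
  also have "\<dots> = (\<Sum>(v, es)\<in>Sigma (verts G) ?W. walk_weight x es * mat_trace (walk_hol G n U es))"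
    by (intro sum.Sigma ballI finite_walks) simp
  also have "\<dots> = (\<Sum>es | closed_w es \<and> length es = m. walk_weight x es * mat_trace (walk_hol G n U es))"
  proof (rule sum.reindex_bij_witness[of _ "\<lambda>es. (tail G (hd es), es)" snd])
    fix p assume "p \<in> Sigma (verts G) ?W"
    then obtain v es where p: "p = (v, es)" "awalk v es v" "length es = m" by auto
    then have "tail G (hd es) = v" using assms by (cases es) (auto simp: awalk_Cons_iff)
    then show "(tail G (hd (snd p)), snd p) = p" "snd p \<in> {es. closed_w es \<and> length es = m}"
      "walk_weight x (snd p) * mat_trace (walk_hol G n U (snd p)) =
       (case p of (v, es) \<Rightarrow> walk_weight x es * mat_trace (walk_hol G n U es))"
      using p assms by (auto simp: closed_w_def)
  next
    fix es assume "es \<in> {es. closed_w es \<and> length es = m}"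
    then obtain v where v: "awalk v es v" "length es = m" "es \<noteq> []"
      by (auto simp: closed_w_def)
    then have "tail G (hd es) = v" by (cases es) (auto simp: awalk_Cons_iff)
    then show "(tail G (hd es), es) \<in> Sigma (verts G) ?W" "snd (tail G (hd es), es) = es"
      using v by (auto intro: awalk_hd_in_verts)
  qed
  finally show ?thesis .
qed


section \<open>Weights of multicycles and of principal minors\<close>

definition cycle_coeff :: "('b \<Rightarrow> complex) \<Rightarrow> 'b list set \<Rightarrow> complex" where
  "cycle_coeff x c = - cycle_weight x c * cycle_tr_hol G n U c / of_nat (cycle_val c)"

definition cycle_length :: "'b list set \<Rightarrow> nat" where
  "cycle_length c = length (representative c)"

lemma cycle_length_pos: "c \<in> cycles G \<Longrightarrow> 0 < cycle_length c"
  using representative_cycle(2)[OF wf_digraph] by (auto simp: cycle_length_def closed_w_def)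

lemma representative_arcs: "c \<in> cycles G \<Longrightarrow> set (representative c) \<subseteq> arcs G"
  using representative_cycle(2)[OF wf_digraph] by (auto simp: closed_w_def awalk_def)

text \<open>
  Identifies the sums in \<open>newton_identity_multisets\<close> with the traces in \<open>newton_identity_det\<close>.
\<close>

lemma sum_cycle_coeff:
  assumes "1 \<le> k"
  shows "(\<Sum>c\<in>{c\<in>cycles G. cycle_length c = k}. of_nat k * cycle_coeff x c) =
    - mat_trace (weighted_adjacency x ^\<^sub>m k)"
proof -
  let ?g = "\<lambda>es. walk_weight x es * mat_trace (walk_hol G n U es)"
  have "(\<Sum>c\<in>{c\<in>cycles G. cycle_length c = k}. of_nat k * cycle_coeff x c) =
      - (\<Sum>c\<in>{c\<in>cycles G. length (representative c) = k}.
            of_nat k * (?g (representative c) / of_nat (cycle_val c)))"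
    unfolding sum_negf[symmetric]
    by (simp add: cycle_coeff_def cycle_length_def cycle_weight_def cycle_tr_hol_def)
  also have "\<dots> = - (\<Sum>es | closed_w es \<and> length es = k. ?g es)"
    by (subst sum_cycles_of_length)
      (simp_all add: walk_weight_rotate mat_trace_walk_hol_rotate[OF wf_digraph _ U])
  finally show ?thesis
    by (simp add: trace_weighted_adjacency_pow[OF assms])
qed

lemma multiset_weight_scale_tail:
  assumes "set_mset C \<subseteq> cycles G"
  shows "multiset_weight (cycle_coeff (\<lambda>e. u (tail G e) * x e)) C =
    multiset_weight (cycle_coeff x) C * (\<Prod>a\<in>verts G. u a ^ multi_visits G a C)"
proof -
  have "cycle_coeff (\<lambda>e. u (tail G e) * x e) c =
      (\<Prod>a\<in>verts G. u a ^ cycle_visits G a c) * cycle_coeff x c" if "c \<in> cycles G" for c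
    using walk_weight_scale_tail[OF wf_digraph finite_verts representative_arcs[OF that], of u x]
    by (simp add: cycle_coeff_def cycle_weight_def cycle_visits_def)
  then have "(\<Prod>c\<in>#C. cycle_coeff (\<lambda>e. u (tail G e) * x e) c) =
      (\<Prod>c\<in>#C. (\<Prod>a\<in>verts G. u a ^ cycle_visits G a c) * cycle_coeff x c)"
    using assms by (intro arg_cong[where f = prod_mset] image_mset_cong) auto
  also have "\<dots> = (\<Prod>a\<in>verts G. u a ^ multi_visits G a C) * (\<Prod>c\<in>#C. cycle_coeff x c)"
    by (induction C) (simp_all add: multi_visits_def power_add prod.distrib)
  finally show ?thesis
    by (simp add: multiset_weight_def)
qed

definition label_visits :: "nat set \<Rightarrow> 'a \<Rightarrow> nat" where
  "label_visits S a = card {i\<in>S. fst (label i) = a}"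

lemma prod_label:
  fixes f :: "'a \<Rightarrow> complex"
  assumes "S \<subseteq> {0..<dimension}"
  shows "(\<Prod>i\<in>S. f (fst (label i))) = (\<Prod>a\<in>verts G. f a ^ label_visits S a)"
proof -
  have fin: "finite S" using assms by (rule finite_subset) simp
  have "(\<Prod>i\<in>S. f (fst (label i))) = (\<Prod>a\<in>verts G. \<Prod>i\<in>{i\<in>S. fst (label i) = a}. f (fst (label i)))"
    using assms label_in fin by (intro prod.group[symmetric]) auto
  also have "\<dots> = (\<Prod>a\<in>verts G. f a ^ label_visits S a)"
    by (intro prod.cong refl) (simp add: label_visits_def)
  finally show ?thesis .
qed

lemma label_visits_compl:
  assumes "S \<subseteq> {0..<dimension}" "a \<in> verts G"
  shows "label_visits ({0..<dimension} - S) a = n a - label_visits S a" "label_visits S a \<le> n a"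
proof -
  let ?T = "{k\<in>{0..<dimension}. fst (label k) = a}"
  let ?S = "{k\<in>S. fst (label k) = a}"
  have sub: "?S \<subseteq> ?T" using assms(1) by auto
  have "{k\<in>{0..<dimension} - S. fst (label k) = a} = ?T - ?S" by auto
  then show "label_visits ({0..<dimension} - S) a = n a - label_visits S a"
    using card_Diff_subset[OF _ sub] card_label[OF assms(2)] finite_subset[OF sub]
    by (simp add: label_visits_def)
  show "label_visits S a \<le> n a"
    using card_mono[OF _ sub] card_label[OF assms(2)] by (simp add: label_visits_def)
qed


section \<open>The determinant as a sum over multicycles\<close>

abbreviation minor_coeff :: "('b \<Rightarrow> complex) \<Rightarrow> nat set \<Rightarrow> complex" where
  "minor_coeff x \<equiv> neg_principal_minor dimension (weighted_adjacency x)"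

abbreviation multicycles_of_length :: "nat \<Rightarrow> 'b list set multiset set" where
  "multicycles_of_length \<equiv> multisets_of_length (cycles G) cycle_length"

text \<open>
  The left-hand side is the coefficient of \<open>t ^ k\<close> in \<open>det (1 - t A\<^sub>u)\<close>, where \<open>A\<^sub>u\<close> is the adjacency
  matrix for the weights \<open>u (tail G e) * x e\<close>; the right-hand side is the weight of the multisets of
  cycles of total length \<open>k\<close> for these weights. Both start at \<open>1\<close> and obey the same Newton recursion, which can
  be solved for the term of index \<open>k > 0\<close> because \<open>k\<close> is invertible in the complex numbers.
\<close>

lemma principal_minors_eq_multicycles:
  "(\<Sum>S\<in>{S\<in>Pow {0..<dimension}. card S = k}. minor_coeff x S * (\<Prod>a\<in>verts G. u a ^ label_visits S a)) =
   (\<Sum>C\<in>multicycles_of_length k.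
      multiset_weight (cycle_coeff x) C * (\<Prod>a\<in>verts G. u a ^ multi_visits G a C))"
proof -
  define xu where "xu = (\<lambda>e. u (tail G e) * x e)"
  define A where "A = weighted_adjacency xu"
  have A: "A \<in> carrier_mat dimension dimension"
    by (simp add: A_def weighted_adjacency_carrier)
  define q where "q = (\<Sum>S\<in>Pow {0..<dimension}.
      monom (minor_coeff x S * (\<Prod>a\<in>verts G. u a ^ label_visits S a)) (card S))"
  define H where "H k = (\<Sum>C\<in>multicycles_of_length k. multiset_weight (cycle_coeff xu) C)" for k
  have "det (1\<^sub>m dimension - t \<cdot>\<^sub>m A) = poly q t" for t
  proof -
    have "1\<^sub>m dimension - t \<cdot>\<^sub>m A = mat dimension dimension (\<lambda>(i, j). (if i = j then 1 else 0) -
        (t * u (fst (label i))) * weighted_adjacency x $$ (i, j))"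
      using A by (intro eq_matI) (auto simp: A_def xu_def weighted_adjacency_scale_tail mult.assoc)
    then have "det (1\<^sub>m dimension - t \<cdot>\<^sub>m A) =
        (\<Sum>S\<in>Pow {0..<dimension}. (\<Prod>i\<in>S. t * u (fst (label i))) * minor_coeff x S)"
      by (simp add: det_diag_minus_row_scaled)
    also have "\<dots> = poly q t"
      unfolding q_def poly_sum poly_monom
      by (intro sum.cong) (auto simp: prod.distrib prod_label)
    finally show ?thesis .
  qed
  note newton = newton_identity_det[OF A this]
  have fin: "finite {c\<in>cycles G. cycle_length c \<le> k}" for k
    using finite_cycles_of_length by (simp add: cycle_length_def)
  have "coeff q k = H k"
  proof (induction k rule: less_induct)
    case (less k)
    show ?case
    proof (cases "k = 0")
      case True
      have "multi_fact ({#} :: 'b list set multiset) = 1" by (simp add: multi_fact_def)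
      then show ?thesis
        using True newton(1) cycle_length_pos
        by (simp add: H_def multisets_of_length_0 multiset_weight_def)
    next
      case False
      have "of_nat k * H k = (\<Sum>j=1..k.
          (\<Sum>c\<in>{c\<in>cycles G. cycle_length c = j}. of_nat j * cycle_coeff xu c) * H (k - j))"
        unfolding H_def using cycle_length_pos fin by (rule newton_identity_multisets)
      also have "\<dots> = (\<Sum>j=1..k. - mat_trace (A ^\<^sub>m j) * coeff q (k - j))"
        using less.IH by (intro sum.cong refl) (simp add: sum_cycle_coeff A_def)
      also have "\<dots> = of_nat k * coeff q k"
        by (simp add: newton(2) sum_negf)
      finally show ?thesis using False by simp
    qed
  qed
  moreover have "coeff q k = (\<Sum>S\<in>{S\<in>Pow {0..<dimension}. card S = k}.
      minor_coeff x S * (\<Prod>a\<in>verts G. u a ^ label_visits S a))"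
    unfolding q_def by (subst sum.inter_filter) (simp_all add: coeff_sum)
  moreover have "H k = (\<Sum>C\<in>multicycles_of_length k.
      multiset_weight (cycle_coeff x) C * (\<Prod>a\<in>verts G. u a ^ multi_visits G a C))"
    unfolding H_def xu_def
    by (intro sum.cong multiset_weight_scale_tail) (auto simp: multisets_of_length_def)
  ultimately show ?thesis by simp
qed

lemma multicycle_length:
  assumes "set_mset C \<subseteq> cycles G"
  shows "(\<Sum>c\<in>#C. cycle_length c) = (\<Sum>a\<in>verts G. multi_visits G a C)"
proof -
  have "(\<Sum>c\<in>#C. cycle_length c) = (\<Sum>c\<in>#C. \<Sum>a\<in>verts G. cycle_visits G a c)"
    using assms sum_walk_visits[OF fin_digraph_axioms representative_arcs]
    by (intro arg_cong[where f = sum_mset] image_mset_cong) (auto simp: cycle_length_def cycle_visits_def)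
  also have "\<dots> = (\<Sum>a\<in>verts G. multi_visits G a C)"
    unfolding multi_visits_def by (induction C) (simp_all add: sum.distrib)
  finally show ?thesis .
qed

lemma dimension_eq: "dimension = (\<Sum>a\<in>verts G. n a)"
  using sum_label[of "\<lambda>_. 1 :: nat"] by simp

text \<open>
  By \<open>monomial_identity_transfer\<close> each monomial with exponents \<open>f\<close> in the variables \<open>u a\<close> may be replaced by
  \<open>\<Prod>a. z a ^ (n a - f a)\<close>, where \<open>z\<close> are the out-weights. The exponents that come from sets of rows
  never exceed \<open>n\<close>; multisets of cycles that exceed \<open>n\<close> at some vertex do occur on the other side, and
  they are removed by letting the functional vanish on their monomials.
\<close>

theorem det_twisted_laplacian:
  "direct_sum_det G n (twisted_laplacian G n x U) =
    (\<Sum>C\<in>bounded_multicycles G n.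
       (\<Prod>a\<in>verts G. out_weight G x a ^ (n a - multi_visits G a C)) / of_nat (multi_fact C) *
       (\<Prod>c\<in>#C. - cycle_weight x c * cycle_tr_hol G n U c / of_nat (cycle_val c)))"
proof -
  define z where "z = out_weight G x"
  define \<phi> where "\<phi> f = (if \<forall>a\<in>verts G. f a \<le> n a then \<Prod>a\<in>verts G. z a ^ (n a - f a) else 0)"
    for f :: "'a \<Rightarrow> nat"
  have \<phi>_cong: "\<phi> f = \<phi> g" if "\<And>a. a \<in> verts G \<Longrightarrow> f a = g a" for f g
    using that by (simp add: \<phi>_def)
  let ?M = multicycles_of_length
  let ?w = "multiset_weight (cycle_coeff x)"
  have finM: "finite (?M k)" for k
    using finite_multisets_of_length[of "cycles G" cycle_length k] cycle_length_pos finite_cycles_of_length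
    by (simp add: cycle_length_def)
  have "direct_sum_det G n (twisted_laplacian G n x U) = (\<Sum>S\<in>Pow {0..<dimension}.
      (\<Prod>i\<in>{0..<dimension} - S. z (fst (label i))) * (\<Prod>i\<in>S. 1) * minor_coeff x S)"
    unfolding direct_sum_det_def direct_sum_matrix_twisted_laplacian z_def
    by (rule det_diag_minus_row_scaled)
  also have "\<dots> = (\<Sum>S\<in>Pow {0..<dimension}. minor_coeff x S * \<phi> (label_visits S))"
    by (intro sum.cong refl)
      (simp add: prod_label \<phi>_def label_visits_compl)
  also have "\<dots> = (\<Sum>k\<le>dimension. \<Sum>S\<in>{S\<in>Pow {0..<dimension}. card S = k}.
      minor_coeff x S * \<phi> (label_visits S))"
    by (intro sum.group[symmetric]) (auto dest: subset_eq_atLeast0_lessThan_card)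
  also have "\<dots> = (\<Sum>k\<le>dimension. \<Sum>C\<in>?M k. ?w C * \<phi> (\<lambda>a. multi_visits G a C))"
    using finM
    by (intro sum.cong refl monomial_identity_transfer[OF finite_verts _ _ principal_minors_eq_multicycles \<phi>_cong])
      auto
  also have "\<dots> = (\<Sum>C\<in>(\<Union>k\<le>dimension. ?M k). ?w C * \<phi> (\<lambda>a. multi_visits G a C))"
    using finM by (intro sum.UNION_disjoint[symmetric]) (auto simp: multisets_of_length_def)
  \<comment> \<open>The bound on all visits bounds the total length by \<open>dimension\<close>, so no multiset is lost by summing over \<open>k\<close> up to \<open>dimension\<close>.\<close>
  also have "\<dots> = (\<Sum>C\<in>bounded_multicycles G n. ?w C * \<phi> (\<lambda>a. multi_visits G a C))"
  proof (rule sum.mono_neutral_right)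
    show "finite (\<Union>k\<le>dimension. ?M k)" using finM by simp
    show "bounded_multicycles G n \<subseteq> (\<Union>k\<le>dimension. ?M k)"
    proof
      fix C assume C: "C \<in> bounded_multicycles G n"
      then have "(\<Sum>c\<in>#C. cycle_length c) \<le> dimension"
        by (auto simp: bounded_multicycles_def multicycle_length dimension_eq intro!: sum_mono)
      with C show "C \<in> (\<Union>k\<le>dimension. ?M k)"
        by (auto simp: multisets_of_length_def bounded_multicycles_def)
    qed
    show "\<forall>C\<in>(\<Union>k\<le>dimension. ?M k) - bounded_multicycles G n. ?w C * \<phi> (\<lambda>a. multi_visits G a C) = 0"
      by (auto simp: multisets_of_length_def bounded_multicycles_def \<phi>_def)
  qed
  also have "\<dots> = (\<Sum>C\<in>bounded_multicycles G n.
       (\<Prod>a\<in>verts G. out_weight G x a ^ (n a - multi_visits G a C)) / of_nat (multi_fact C) *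
       (\<Prod>c\<in>#C. - cycle_weight x c * cycle_tr_hol G n U c / of_nat (cycle_val c)))"
    by (intro sum.cong refl)
      (auto simp: multiset_weight_def cycle_coeff_def \<phi>_def z_def bounded_multicycles_def)
  finally show ?thesis .
qed

end

theorem theorem1p5:
  fixes G :: "(nat, 'e) pre_digraph"
    and p :: nat
    and n :: "nat \<Rightarrow> nat"
    and x :: "'e \<Rightarrow> complex"
    and U :: "'e \<Rightarrow> complex mat"
  assumes "fin_digraph G"
    and "loopfree_digraph G"
    and "verts G = {1..p}"
    and "\<And>v. v \<in> verts G \<Longrightarrow> n v \<ge> 1"
    and "\<And>e. e \<in> arcs G \<Longrightarrow> U e \<in> carrier_mat (n (tail G e)) (n (head G e))"
  shows "direct_sum_det G n (twisted_laplacian G n x U) =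
    (\<Sum>C\<in>bounded_multicycles G n.
       (\<Prod>a\<in>verts G. out_weight G x a ^ (n a - multi_visits G a C)) / of_nat (multi_fact C) *
       (\<Prod>c\<in>#C. - cycle_weight x c * cycle_tr_hol G n U c / of_nat (cycle_val c)))"
proof -
  interpret fin_digraph G by fact
  interpret twisted_quiver G n U
    by unfold_locales (fact assms(5))
  show ?thesis by (rule det_twisted_laplacian)
qed

end
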